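(* Let $D>0$, $p\in\mathbb{R}$, $c\ge0$ be constants and let $k,l\in C^2([0,1]^2;\mathbb{R})$ be backstepping kernels for $(D,p,c)$ as described in the context. Consider the closed-loop system $$\frac{\partial y}{\partial t}(t,z)=D\frac{\partial^2y}{\partial z^2}(t,z)+p\,y(t,z),\quad(t,z)\in(0,+\infty)\times(0,1),$$ $$y(t,0)=d(t)-\int_0^1k(0,s)y(t,s)\,ds,\qquad y(t,1)=0,\qquad t\ge0,$$ where $d$ represents control actuator errors. Then for every $d\in C^2(\mathbb{R}_+;\mathbb{R})$ and every $y_0\in C^2([0,1];\mathbb{R})$ with $y_0(0)=d(0)-\int_0^1k(0,s)y_0(s)\,ds$ and $y_0(1)=0$, the solution of the closed-loop system with initial condition $y(0,\cdot)=y_0$ is unique, is defined for all $t\ge0$, and satisfies, for all $t\ge0$ and $\varepsilon>0$, $$\|y[t]\|\le\exp\left(-(c+D\pi^2)t\right)\left(1+\sqrt{\int_0^1\left(\int_z^1l^2(z,s)ds\right)dz}\right)\left(1+\sqrt{\int_0^1\left(\int_z^1k^2(z,s)ds\right)dz}\right)\|y_0\|\sqrt{1+\varepsilon}$$ $$\qquad+\left(1+\sqrt{\int_0^1\left(\int_z^1l^2(z,s)ds\right)dz}\right)\sqrt{1+\varepsilon^{-1}}\;G\max_{0\le s\le t}|d(s)|,$$ where, with $\zeta:=\sqrt{c/D}$, $$G:=\frac{\sqrt2}{\pi}\sqrt{\sum_{n=1}^\infty\frac{n^2}{\left(\pi^{-2}\zeta^2+n^2\right)^2}}=\frac{1}{\exp(2\zeta)-1}\sqrt{\frac{\exp(4\zeta)-1-4\zeta\exp(2\zeta)}{2\zeta}}\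 \text{ if } c>0,\qquad G:=\frac{\sqrt2}{\pi}\sqrt{\sum_{n=1}^\infty\frac1{n^2}}=\frac1{\sqrt3}\ \text{ if } c=0 .$$
   Context: $\mathbb{R}_+=[0,+\infty)$; $\|x\|=\sqrt{\int_0^1x^2(z)dz}$ is the standard $L^2$ norm; $y[t]$ denotes the profile $z\mapsto y(t,z)$. "Solution" (of this problem or the target problem below) means a function in $C^0(\mathbb{R}_+\times[0,1];\mathbb{R})\cap C^1((0,+\infty)\times[0,1];\mathbb{R})$ whose profile at every $t\ge0$ is in $C^2([0,1];\mathbb{R})$, satisfying the PDE on $(0,+\infty)\times(0,1)$, the boundary conditions for all $t\ge0$, and the initial condition. Backstepping kernels for $(D,p,c)$: functions $k,l\in C^2([0,1]^2;\mathbb{R})$ such that the Volterra transformations $$x(t,z)=y(t,z)+\int_z^1k(z,s)y(t,s)\,ds,\qquad y(t,z)=x(t,z)+\int_z^1l(z,s)x(t,s)\,ds$$ are inverse to each other and, for every $d\in C^2(\mathbb{R}_+;\mathbb{R})$, transform solutions $y$ of the closed-loop system into solutions $x$ of the target problem $$\frac{\partial x}{\partial t}(t,z)=D\frac{\partial^2x}{\partial z^2}(t,z)-c\,x(t,z)\ \text{ on }(0,+\infty)\times(0,1),\qquad x(t,0)=d(t),\quad x(t,1)=0\ \text{ for all }t\ge0,$$ and vice versa. (The existence of such kernels is known from the backstepping literature and is taken as given.) *)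

theory Defs
  imports "HOL-Analysis.Analysis"
begin

text \<open>
  Regularity on a set that need not be open: derivatives are taken within the set, so they are
  one-sided at boundary points. All sets used below are convex with nonempty interior, where the
  derivative within the set is unique.
\<close>

definition C1_on :: "'a::real_normed_vector set \<Rightarrow> ('a \<Rightarrow> 'b::real_normed_vector) \<Rightarrow> bool" where
  "C1_on S f \<longleftrightarrow>
     (\<exists>f' :: 'a \<Rightarrow> 'a \<Rightarrow>\<^sub>L 'b.
        (\<forall>x\<in>S. (f has_derivative blinfun_apply (f' x)) (at x within S)) \<and> continuous_on S f')"

definition C2_on :: "'a::real_normed_vector set \<Rightarrow> ('a \<Rightarrow> 'b::real_normed_vector) \<Rightarrow> bool" where
  "C2_on S f \<longleftrightarrow>
     (\<exists>f' :: 'a \<Rightarrow> 'a \<Rightarrow>\<^sub>L 'b.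
        (\<forall>x\<in>S. (f has_derivative blinfun_apply (f' x)) (at x within S)) \<and> C1_on S f')"

definition L2_norm01 :: "(real \<Rightarrow> real) \<Rightarrow> real" where
  "L2_norm01 f = sqrt (integral {0..1} (\<lambda>z. (f z)\<^sup>2))"

definition kernel_norm :: "(real \<Rightarrow> real \<Rightarrow> real) \<Rightarrow> real" where
  "kernel_norm k = sqrt (integral {0..1} (\<lambda>z. integral {z..1} (\<lambda>s. (k z s)\<^sup>2)))"

text \<open>
  Solutions of \<open>u\<^sub>t = D u\<^sub>z\<^sub>z + r u\<close> with \<open>u(t,0) = b(t)\<close> and \<open>u(t,1) = 0\<close>, for arbitrary initial data.
  Only the values of \<open>u\<close> on \<open>t \<ge> 0\<close>, \<open>0 \<le> z \<le> 1\<close> matter; the two-sided \<open>deriv\<close> is used at interior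
  points only, where the regularity conditions guarantee that the derivatives exist.
\<close>

definition dirichlet_solution ::
  "real \<Rightarrow> real \<Rightarrow> (real \<Rightarrow> real) \<Rightarrow> (real \<Rightarrow> real \<Rightarrow> real) \<Rightarrow> bool" where
  "dirichlet_solution D r b u \<longleftrightarrow>
     continuous_on ({0..} \<times> {0..1}) (\<lambda>(t, z). u t z) \<and>
     C1_on ({0<..} \<times> {0..1}) (\<lambda>(t, z). u t z) \<and>
     (\<forall>t\<ge>0. C2_on {0..1} (u t)) \<and>
     (\<forall>t>0. \<forall>z\<in>{0<..<1}. deriv (\<lambda>\<tau>. u \<tau> z) t = D * deriv (deriv (u t)) z + r * u t z) \<and>
     (\<forall>t\<ge>0. u t 0 = b t \<and> u t 1 = 0)"

definition closed_loop_solution ::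
  "real \<Rightarrow> real \<Rightarrow> (real \<Rightarrow> real \<Rightarrow> real) \<Rightarrow> (real \<Rightarrow> real) \<Rightarrow> (real \<Rightarrow> real \<Rightarrow> real) \<Rightarrow> bool" where
  "closed_loop_solution D p k d y \<longleftrightarrow>
     dirichlet_solution D p (\<lambda>t. d t - integral {0..1} (\<lambda>s. k 0 s * y t s)) y"

definition target_solution ::
  "real \<Rightarrow> real \<Rightarrow> (real \<Rightarrow> real) \<Rightarrow> (real \<Rightarrow> real \<Rightarrow> real) \<Rightarrow> bool" where
  "target_solution D c d x \<longleftrightarrow> dirichlet_solution D (- c) d x"

definition volterra :: "(real \<Rightarrow> real \<Rightarrow> real) \<Rightarrow> (real \<Rightarrow> real) \<Rightarrow> real \<Rightarrow> real" where
  "volterra k f z = f z + integral {z..1} (\<lambda>s. k z s * f s)"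

definition backstepping_kernels ::
  "real \<Rightarrow> real \<Rightarrow> real \<Rightarrow> (real \<Rightarrow> real \<Rightarrow> real) \<Rightarrow> (real \<Rightarrow> real \<Rightarrow> real) \<Rightarrow> bool" where
  "backstepping_kernels D p c k l \<longleftrightarrow>
     C2_on ({0..1} \<times> {0..1}) (\<lambda>(z, s). k z s) \<and>
     C2_on ({0..1} \<times> {0..1}) (\<lambda>(z, s). l z s) \<and>
     (\<forall>f. continuous_on {0..1} f \<longrightarrow>
        (\<forall>z\<in>{0..1}. volterra l (volterra k f) z = f z \<and> volterra k (volterra l f) z = f z)) \<and>
     (\<forall>d. C2_on {0..} d \<longrightarrow>
        (\<forall>y. closed_loop_solution D p k d y \<longrightarrow> target_solution D c d (\<lambda>t. volterra k (y t))) \<and>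
        (\<forall>x. target_solution D c d x \<longrightarrow> closed_loop_solution D p k d (\<lambda>t. volterra l (x t))))"

text \<open>The series over \<open>n \<ge> 1\<close> are indexed by \<open>Suc n\<close>; \<open>\<zeta> = sqrt (c / D)\<close>.\<close>

definition iss_gain :: "real \<Rightarrow> real \<Rightarrow> real" where
  "iss_gain D c =
     (if c > 0
      then sqrt 2 / pi * sqrt (\<Sum>n. (real (Suc n))\<^sup>2 / ((sqrt (c / D))\<^sup>2 / pi\<^sup>2 + (real (Suc n))\<^sup>2)\<^sup>2)
      else sqrt 2 / pi * sqrt (\<Sum>n. 1 / (real (Suc n))\<^sup>2))"

end

(*
Under the Volterra transformation the closed loop becomes the heat-type target problem, so existence,
uniqueness and the estimate are proved for the latter and carried back.

On the target problem everything is read off the sine coefficients a_n(t) of the profile, which satisfy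
a_n' = -(c + D n^2 pi^2) a_n + 2 D n pi d(t): uniqueness is completeness of the sine system, and the
estimate follows from (a + b)^2 <= (1 + eps) a^2 + (1 + 1/eps) b^2 in each mode and Parseval's identity.
Completeness comes from the Weierstrass theorem, since the sine polynomials are the functions
sin(pi z) q(cos(pi z)) with q a polynomial. The gain G is the L^2 norm of the stationary profile with
boundary values 1 and 0, which gives both its series and its closed form.
*)

theory Submission
  imports Defs
begin

section \<open>The sine system on the unit interval\<close>

text \<open>The closed-loop boundary condition involves the whole profile, so projecting that system
  on sines would couple all modes; this is why the spectral work happens on the target side. The
  kernels are only known to carry solutions to solutions, so initial data need their own passage: a
  Volterra transform preserves C^2, and its value at 0 turns the compatibility of y_0 into x_0(0) =
  d(0). The main obstacle is existence. A nonzero boundary value lets the sine coefficients decay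
  only like 1/n, so the plain sine series of the solution cannot be differentiated termwise and
  explicit polynomials in z must be split off. Moreover the data match only to order zero at the
  corner: D x_0''(0) - c x_0(0) may differ from d'(0). Derivatives are therefore controlled only on
  time intervals away from 0, where the exponential factor gains n^2, and the C^2 profile at t = 0
  is that of x_0 itself.\<close>

definition freq :: "nat \<Rightarrow> real" where
  "freq n = real (Suc n) * pi"

definition sine_mode :: "nat \<Rightarrow> real \<Rightarrow> real" where
  "sine_mode n z = sin (freq n * z)"

text \<open>The factor 2 is the reciprocal of the squared norm 1/2 of a mode. These are thus the
  coefficients of the expansion in \<open>sine_mode\<close>, and Parseval's identity carries the
  factor 1/2.\<close>

definition sine_coeff :: "(real \<Rightarrow> real) \<Rightarrow> nat \<Rightarrow> real" where
  "sine_coeff f n = 2 * integral {0..1} (\<lambda>z. f z * sine_mode n z)"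

lemma freq_pos [simp]: "0 < freq n"
  by (simp add: freq_def)

lemma freq_ge_pi: "pi \<le> freq n"
  by (simp add: freq_def field_simps)

lemma sin_freq [simp]: "sin (freq n) = 0"
  unfolding freq_def by (rule sin_npi)

lemma sine_mode_0 [simp]: "sine_mode n 0 = 0"
  and sine_mode_1 [simp]: "sine_mode n 1 = 0"
  by (simp_all add: sine_mode_def)

lemma abs_sine_mode_le_1 [simp]: "\<bar>sine_mode n z\<bar> \<le> 1"
  by (simp add: sine_mode_def)

lemma continuous_on_sine_mode [continuous_intros]:
  fixes g :: "'a::t2_space \<Rightarrow> real"
  shows "continuous_on S g \<Longrightarrow> continuous_on S (\<lambda>z. sine_mode n (g z))"
  unfolding sine_mode_def by (intro continuous_intros)

lemma has_integral_cos_mult: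
  fixes w :: real
  assumes "w \<noteq> 0"
  shows "((\<lambda>z. cos (w * z)) has_integral sin w / w) {0..1}"
proof -
  have "((\<lambda>z. cos (w * z)) has_integral (sin (w * 1) / w - sin (w * 0) / w)) {0..1}"
    by (rule fundamental_theorem_of_calculus)
       (auto intro!: derivative_eq_intros simp: has_real_derivative_iff_has_vector_derivative[symmetric] assms)
  then show ?thesis by simp
qed

lemma sine_mode_orthogonal:
  "((\<lambda>z. sine_mode m z * sine_mode n z) has_integral (if m = n then 1/2 else 0)) {0..1}"
proof -
  have prod: "sine_mode m z * sine_mode n z
      = (cos ((freq m - freq n) * z) - cos ((freq m + freq n) * z)) / 2" for z
    by (simp add: sine_mode_def sin_times_sin left_diff_distrib distrib_right)
  have sum: "((\<lambda>z. cos ((freq m + freq n) * z)) has_integral 0) {0..1}"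
    using has_integral_cos_mult[of "freq m + freq n"] freq_pos[of m] freq_pos[of n]
    by (simp add: sin_add)
  have diff: "((\<lambda>z. cos ((freq m - freq n) * z)) has_integral (if m = n then 1 else 0)) {0..1}"
  proof (cases "m = n")
    case True
    then show ?thesis using has_integral_const_real[of "1::real" 0 1] by simp
  next
    case False
    then have "freq m - freq n \<noteq> 0" by (simp add: freq_def)
    from has_integral_cos_mult[OF this] False show ?thesis by (simp add: sin_diff)
  qed
  have "((\<lambda>z. (cos ((freq m - freq n) * z) - cos ((freq m + freq n) * z)) / 2)
      has_integral ((if m = n then 1 else 0) - 0) / 2) {0..1}"
    by (intro has_integral_divide has_integral_diff diff sum)
  then show ?thesis unfolding prod by (simp split: if_splits)
qed

lemma integrable_mult_sine_mode:
  assumes "continuous_on {0..1} f"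
  shows "(\<lambda>z. f z * sine_mode n z) integrable_on {0..1}"
  by (intro integrable_continuous_real continuous_intros assms)

lemma has_integral_sine_coeff:
  assumes "continuous_on {0..1} f"
  shows "((\<lambda>z. f z * sine_mode n z) has_integral sine_coeff f n / 2) {0..1}"
  using integrable_integral[OF integrable_mult_sine_mode[OF assms]] by (simp add: sine_coeff_def)

text \<open>Expand the square, use orthogonality, and complete the square in each
  \<open>b n\<close>. The choice of \<open>b\<close> enters only through its distance to the sine
  coefficients, so this one identity contains both Bessel's inequality and the best approximation
  property.\<close>

lemma has_integral_sine_poly_error:
  assumes f: "continuous_on {0..1} f"
  shows "((\<lambda>z. (f z - (\<Sum>n<N. b n * sine_mode n z))\<^sup>2) has_integral
           integral {0..1} (\<lambda>z. (f z)\<^sup>2) - (\<Sum>n<N. (sine_coeff f n)\<^sup>2) / 2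
             + (\<Sum>n<N. (b n - sine_coeff f n)\<^sup>2) / 2) {0..1}"
proof -
  have sq: "((\<lambda>z. (f z)\<^sup>2) has_integral integral {0..1} (\<lambda>z. (f z)\<^sup>2)) {0..1}"
    by (intro integrable_integral integrable_continuous_real continuous_intros f)
  have cross: "((\<lambda>z. \<Sum>n<N. 2 * b n * (f z * sine_mode n z)) has_integral
      (\<Sum>n<N. 2 * b n * (sine_coeff f n / 2))) {0..1}"
    by (intro has_integral_sum has_integral_mult_right has_integral_sine_coeff f) auto
  have "((\<lambda>z. \<Sum>m<N. \<Sum>n<N. b m * b n * (sine_mode m z * sine_mode n z)) has_integral
      (\<Sum>m<N. \<Sum>n<N. b m * b n * (if m = n then 1/2 else 0))) {0..1}"
    by (intro has_integral_sum has_integral_mult_right sine_mode_orthogonal) auto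
  also have "(\<Sum>m<N. \<Sum>n<N. b m * b n * (if m = n then 1/2 else 0)) = (\<Sum>n<N. (b n)\<^sup>2) / 2"
    by (simp add: if_distrib sum_divide_distrib power2_eq_square cong: if_cong)
  finally have poly: "((\<lambda>z. \<Sum>m<N. \<Sum>n<N. b m * b n * (sine_mode m z * sine_mode n z)) has_integral
      (\<Sum>n<N. (b n)\<^sup>2) / 2) {0..1}" .
  have "(f z - (\<Sum>n<N. b n * sine_mode n z))\<^sup>2
      = (f z)\<^sup>2 - (\<Sum>n<N. 2 * b n * (f z * sine_mode n z))
          + (\<Sum>m<N. \<Sum>n<N. b m * b n * (sine_mode m z * sine_mode n z))" for z
    unfolding power2_diff power2_eq_square[of "sum _ _"] sum_product
    by (simp add: sum_distrib_left sum_distrib_right algebra_simps)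
  moreover have "integral {0..1} (\<lambda>z. (f z)\<^sup>2) - (\<Sum>n<N. 2 * b n * (sine_coeff f n / 2))
        + (\<Sum>n<N. (b n)\<^sup>2) / 2
      = integral {0..1} (\<lambda>z. (f z)\<^sup>2) - (\<Sum>n<N. (sine_coeff f n)\<^sup>2) / 2
          + (\<Sum>n<N. (b n - sine_coeff f n)\<^sup>2) / 2"
    by (simp add: power2_diff sum.distrib sum_subtractf sum_distrib_left[symmetric] mult.assoc
        diff_divide_distrib add_divide_distrib)
  ultimately show ?thesis
    using has_integral_add[OF has_integral_diff[OF sq cross] poly] by (simp only:)
qed

section \<open>Sine polynomials and the completeness of the sine system\<close>

definition sine_poly :: "(real \<Rightarrow> real) \<Rightarrow> bool" where
  "sine_poly p \<longleftrightarrow> (\<exists>N b. \<forall>z. p z = (\<Sum>n<N. b n * sine_mode n z))"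

text \<open>Padding with zero coefficients. It allows two sine polynomials to be written over one
  common range before they are added.\<close>

lemma sine_poly_iff_mono:
  "sine_poly p \<longleftrightarrow> (\<exists>N. \<forall>M\<ge>N. \<exists>b. \<forall>z. p z = (\<Sum>n<M. b n * sine_mode n z))"
proof
  assume "sine_poly p"
  then obtain N b where p: "\<And>z. p z = (\<Sum>n<N. b n * sine_mode n z)"
    unfolding sine_poly_def by blast
  have "p z = (\<Sum>n<M. (if n < N then b n else 0) * sine_mode n z)" if "N \<le> M" for M z
    unfolding p by (rule sum.mono_neutral_cong_left) (use that in auto)
  then show "\<exists>N. \<forall>M\<ge>N. \<exists>b. \<forall>z. p z = (\<Sum>n<M. b n * sine_mode n z)"
    by (intro exI[of _ N] allI impI exI[of _ "\<lambda>n. if n < N then b n else 0"]) auto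
qed (unfold sine_poly_def, blast)

lemma sine_poly_add:
  assumes "sine_poly p" "sine_poly q"
  shows "sine_poly (\<lambda>z. p z + q z)"
proof -
  obtain N N' where N: "\<forall>M\<ge>N. \<exists>b. \<forall>z. p z = (\<Sum>n<M. b n * sine_mode n z)"
      and N': "\<forall>M\<ge>N'. \<exists>b. \<forall>z. q z = (\<Sum>n<M. b n * sine_mode n z)"
    using assms unfolding sine_poly_iff_mono by blast
  obtain b where b: "\<And>z. p z = (\<Sum>n<max N N'. b n * sine_mode n z)"
    using N[rule_format, of "max N N'"] by auto
  obtain b' where b': "\<And>z. q z = (\<Sum>n<max N N'. b' n * sine_mode n z)"
    using N'[rule_format, of "max N N'"] by auto
  have "p z + q z = (\<Sum>n<max N N'. (b n + b' n) * sine_mode n z)" for z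
    by (simp add: b b' distrib_right sum.distrib)
  then show ?thesis
    unfolding sine_poly_def by (intro exI allI)
qed

lemma sine_poly_cmult:
  assumes "sine_poly p"
  shows "sine_poly (\<lambda>z. a * p z)"
proof -
  obtain N b where "\<And>z. p z = (\<Sum>n<N. b n * sine_mode n z)"
    using assms unfolding sine_poly_def by blast
  then have "a * p z = (\<Sum>n<N. (a * b n) * sine_mode n z)" for z
    by (simp add: sum_distrib_left algebra_simps)
  then show ?thesis unfolding sine_poly_def by (intro exI[of _ N] exI[of _ "\<lambda>n. a * b n"]) auto
qed

lemma sine_poly_sum:
  "(\<And>i. i \<in> I \<Longrightarrow> sine_poly (p i)) \<Longrightarrow> sine_poly (\<lambda>z. \<Sum>i\<in>I. p i z)"
proof (induction I rule: infinite_finite_induct)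
  case (insert i I)
  then show ?case by (simp add: sine_poly_add)
next
qed (auto simp: sine_poly_def intro!: exI[of _ 0])

lemma sine_poly_sine_mode: "sine_poly (sine_mode n)"
  unfolding sine_poly_def
  by (intro exI[of _ "Suc n"] exI[of _ "\<lambda>m. if m = n then 1 else 0"]) (auto simp: if_distrib cong: if_cong)

text \<open>Multiplication by cos(pi z) moves a frequency one step up and one step down, each with
  weight 1/2. The lowest mode has no lower neighbour: its downward term is sin 0, which is why it is
  a separate case.\<close>

lemma sine_poly_mult_cos:
  assumes "sine_poly p"
  shows "sine_poly (\<lambda>z. p z * cos (pi * z))"
proof -
  have mode: "sine_poly (\<lambda>z. sine_mode n z * cos (pi * z))" for n
  proof (cases n)
    case 0
    have "sine_mode n z * cos (pi * z) = 1/2 * sine_mode 1 z" for z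
      using sin_double[of "pi * z"] by (simp add: 0 sine_mode_def freq_def mult.assoc)
    then show ?thesis using sine_poly_cmult[OF sine_poly_sine_mode, of "1/2" 1] by presburger
  next
    case (Suc m)
    have f: "freq (Suc n) * z = freq n * z + pi * z" "freq m * z = freq n * z - pi * z" for z
      by (simp_all add: Suc freq_def algebra_simps)
    have "sine_mode n z * cos (pi * z) = 1/2 * sine_mode (Suc n) z + 1/2 * sine_mode m z" for z
      unfolding sine_mode_def f sin_add sin_diff by (simp add: field_simps)
    then show ?thesis
      using sine_poly_add[OF sine_poly_cmult[OF sine_poly_sine_mode, of "1/2" "Suc n"]
          sine_poly_cmult[OF sine_poly_sine_mode, of "1/2" m]] by simp
  qed
  obtain N b where p: "\<And>z. p z = (\<Sum>n<N. b n * sine_mode n z)"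
    using assms unfolding sine_poly_def by blast
  have "sine_poly (\<lambda>z. \<Sum>n<N. b n * (sine_mode n z * cos (pi * z)))"
    by (intro sine_poly_sum sine_poly_cmult mode)
  then show ?thesis by (simp add: p sum_distrib_right mult.assoc)
qed

text \<open>Induction on the power of the cosine, starting from the lowest mode sin(pi z). With u =
  cos(pi z), approximation by sines becomes polynomial approximation on [-1, 1].\<close>

lemma sine_poly_sin_mult_poly_cos:
  assumes "real_polynomial_function q"
  shows "sine_poly (\<lambda>z. sin (pi * z) * q (cos (pi * z)))"
proof -
  obtain a n where q: "q = (\<lambda>x. \<Sum>i\<le>n. a i * x ^ i)"
    using assms real_polynomial_function_iff_sum by auto
  have pow: "sine_poly (\<lambda>z. sin (pi * z) * cos (pi * z) ^ i)" for i
  proof (induction i)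
    case 0
    then show ?case using sine_poly_sine_mode[of 0] by (simp add: sine_mode_def[abs_def] freq_def)
  next
    case (Suc i)
    then show ?case using sine_poly_mult_cos[OF Suc] by (simp add: mult_ac)
  qed
  have "sine_poly (\<lambda>z. \<Sum>i\<le>n. a i * (sin (pi * z) * cos (pi * z) ^ i))"
    by (intro sine_poly_sum sine_poly_cmult pow)
  then show ?thesis by (simp add: q sum_distrib_left mult_ac)
qed

text \<open>Multiplying by \<open>1 - (1 - sin (\<pi>z))\<^sup>k\<close> removes the boundary values at small cost in
  \<open>L\<^sup>2\<close>; the result is \<open>sin (\<pi>z)\<close> times a continuous function of \<open>cos (\<pi>z)\<close>, to which the
  Weierstrass theorem applies.\<close>

lemma sine_poly_dense:
  assumes f: "continuous_on {0..1} f" and "0 < e"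
  shows "\<exists>p. sine_poly p \<and> integral {0..1} (\<lambda>z. (f z - p z)\<^sup>2) < e"
proof -
  define r where "r k z = (f z * (1 - sin (pi * z)) ^ k)\<^sup>2" for k z
  have sin01: "0 \<le> sin (pi * z)" if "z \<in> {0..1}" for z
    using that by (intro sin_ge_zero) (auto simp: mult_le_cancel_left1)
  \<comment> \<open>The base 1 - sin(pi z) lies in [0, 1) on the open interval and equals 1 at the
    two endpoints, so the pointwise limit lives on a null set.\<close>
  have "(\<lambda>k. integral {0..1} (r k)) \<longlonglongrightarrow> integral {0..1} (\<lambda>z. if z \<in> {0, 1} then (f z)\<^sup>2 else 0)"
  proof (rule dominated_convergence)
    show "r k integrable_on {0..1}" for k
      unfolding r_def by (intro integrable_continuous_real continuous_intros f)
    show "(\<lambda>z. (f z)\<^sup>2) integrable_on {0..1}"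
      by (intro integrable_continuous_real continuous_intros f)
    show "norm (r k z) \<le> (f z)\<^sup>2" if "z \<in> {0..1}" for k z
    proof -
      have "((1 - sin (pi * z)) ^ k)\<^sup>2 \<le> 1"
        using sin01[OF that] by (intro power_le_one zero_le_power) auto
      then show ?thesis by (simp add: r_def power_mult_distrib mult_left_le)
    qed
    show "(\<lambda>k. r k z) \<longlonglongrightarrow> (if z \<in> {0, 1} then (f z)\<^sup>2 else 0)" if "z \<in> {0..1}" for z
    proof (cases "z \<in> {0, 1}")
      case True
      then show ?thesis by (auto simp: r_def)
    next
      case False
      then have "0 < sin (pi * z)" using that by (intro sin_gt_zero) auto
      moreover have "sin (pi * z) < 2" by (rule le_less_trans[OF sin_le_one]) simp
      ultimately have "(\<lambda>k. (f z * (1 - sin (pi * z)) ^ k)\<^sup>2) \<longlonglongrightarrow> (f z * 0)\<^sup>2"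
        by (intro tendsto_intros LIMSEQ_power_zero) (auto simp: abs_if)
      then show ?thesis using False by (simp add: r_def)
    qed
  qed
  also have "integral {0..1} (\<lambda>z. if z \<in> {0, 1} then (f z)\<^sup>2 else 0) = 0"
  proof (rule integral_unique)
    show "((\<lambda>z. if z \<in> {0, 1} then (f z)\<^sup>2 else 0) has_integral 0) {0..1}"
      by (rule has_integral_spike[OF _ _ has_integral_0, where S = "{0, 1}"]) auto
  qed
  finally have "(\<lambda>k. integral {0..1} (r k)) \<longlonglongrightarrow> 0" by simp
  then have "\<forall>\<^sub>F k in sequentially. integral {0..1} (r k) < e / 4"
    using \<open>0 < e\<close> by (intro order_tendstoD) auto
  then obtain k where k: "integral {0..1} (r k) < e / 4"
    using eventually_happens by fastforce
  \<comment> \<open>The geometric sum is (1 - (1 - s)^k) / s with s = sin(pi z), written without the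
    division. Hence s times \<open>g (cos (pi * z))\<close> is f(z) (1 - (1 - s)^k), and
    \<open>g\<close> stays continuous up to the endpoints.\<close>
  define g where "g u = f (arccos u / pi) * (\<Sum>j<k. (1 - sin (arccos u)) ^ j)" for u
  have "continuous_on {-1..1} g"
    unfolding g_def
    by (intro continuous_intros continuous_on_compose2[OF f])
       (auto simp: arccos_lbound arccos_ubound)
  \<comment> \<open>This tolerance squares to e/4. By (a + b)^2 \<le> 2 a^2 + 2 b^2 the cutoff error
    and the polynomial error then contribute less than e/2 and at most e/2.\<close>
  then obtain q where q: "real_polynomial_function q"
      "\<And>u. u \<in> {-1..1} \<Longrightarrow> \<bar>g u - q u\<bar> < sqrt (e / 4)"
    using Stone_Weierstrass_real_polynomial_function[of "{-1..1}" g "sqrt (e/4)"] \<open>0 < e\<close> by auto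
  define p where "p z = sin (pi * z) * q (cos (pi * z))" for z
  have p: "sine_poly p"
    unfolding p_def using q(1) by (rule sine_poly_sin_mult_poly_cos)
  then obtain N b where pN: "\<And>z. p z = (\<Sum>n<N. b n * sine_mode n z)"
    unfolding sine_poly_def by blast
  have "(f z - p z)\<^sup>2 \<le> 2 * r k z + 2 * (e / 4)" if z: "z \<in> {0..1}" for z
  proof -
    define s where "s = sin (pi * z)"
    have s: "0 \<le> s" "s \<le> 1" using sin01[OF z] by (auto simp: s_def)
    have "0 \<le> pi * z" "pi * z \<le> pi" using z by (auto simp: mult_le_cancel_left1)
    then have "arccos (cos (pi * z)) = pi * z" by (simp add: arccos_cos)
    then have "s * g (cos (pi * z)) = f z * (s * (\<Sum>j<k. (1 - s) ^ j))"
      by (simp add: g_def s_def)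
    also have "s * (\<Sum>j<k. (1 - s) ^ j) = 1 - (1 - s) ^ k"
      by (subst one_diff_power_eq) simp
    finally have "f z - p z = f z * (1 - s) ^ k + s * (g (cos (pi * z)) - q (cos (pi * z)))"
      by (simp add: p_def s_def algebra_simps)
    moreover have "(s * (g (cos (pi * z)) - q (cos (pi * z))))\<^sup>2 \<le> (sqrt (e / 4))\<^sup>2"
    proof (rule power2_le_iff_abs_le[THEN iffD2])
      have "\<bar>s\<bar> * \<bar>g (cos (pi * z)) - q (cos (pi * z))\<bar> \<le> 1 * sqrt (e / 4)"
        using s q(2)[of "cos (pi * z)"] by (intro mult_mono) auto
      then show "\<bar>s * (g (cos (pi * z)) - q (cos (pi * z)))\<bar> \<le> sqrt (e / 4)"
        by (simp add: abs_mult)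
    qed (use \<open>0 < e\<close> in auto)
    moreover have "(a + b)\<^sup>2 \<le> 2 * a\<^sup>2 + 2 * b\<^sup>2" for a b :: real
      using sum_squares_bound[of a b] by (simp add: power2_sum)
    ultimately show ?thesis
      using \<open>0 < e\<close> by (smt (verit, best) r_def s_def real_sqrt_pow2 divide_nonneg_nonneg)
  qed
  then have "integral {0..1} (\<lambda>z. (f z - p z)\<^sup>2) \<le> integral {0..1} (\<lambda>z. 2 * r k z + 2 * (e / 4))"
    unfolding pN r_def
    by (intro integral_le integrable_continuous_real continuous_intros f) auto
  also have "\<dots> = 2 * integral {0..1} (r k) + 2 * (e / 4)"
    unfolding r_def
    by (subst integral_add) (auto intro!: integrable_continuous_real continuous_intros f)
  also have "\<dots> < e" using k by simp
  finally show ?thesis using p by blast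
qed

text \<open>Bessel's inequality bounds every partial sum by the integral. Density provides one sine
  polynomial within e, replacing its coefficients by the sine coefficients only lowers the error,
  and since the partial sums increase, closeness at one N persists for all larger ones.\<close>

theorem sine_parseval:
  assumes f: "continuous_on {0..1} f"
  shows "(\<lambda>n. (sine_coeff f n)\<^sup>2 / 2) sums integral {0..1} (\<lambda>z. (f z)\<^sup>2)"
proof -
  let ?I = "integral {0..1} (\<lambda>z. (f z)\<^sup>2)"
  let ?S = "\<lambda>N. \<Sum>n<N. (sine_coeff f n)\<^sup>2 / 2"
  have err: "integral {0..1} (\<lambda>z. (f z - (\<Sum>n<N. b n * sine_mode n z))\<^sup>2)
      = ?I - ?S N + (\<Sum>n<N. (b n - sine_coeff f n)\<^sup>2) / 2" for N b
    using integral_unique[OF has_integral_sine_poly_error[OF f, where N = N and b = b]]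
    by (simp add: sum_divide_distrib)
  have bessel: "?S N \<le> ?I" for N
  proof -
    have "0 \<le> integral {0..1} (\<lambda>z. (f z - (\<Sum>n<N. sine_coeff f n * sine_mode n z))\<^sup>2)"
      by (intro integral_nonneg integrable_continuous_real continuous_intros f) auto
    then show ?thesis unfolding err by simp
  qed
  have "?S \<longlonglongrightarrow> ?I"
  proof (rule LIMSEQ_I)
    fix e :: real assume "0 < e"
    then obtain p where p: "sine_poly p" "integral {0..1} (\<lambda>z. (f z - p z)\<^sup>2) < e"
      using sine_poly_dense[OF f] by blast
    then obtain N b where "\<And>z. p z = (\<Sum>n<N. b n * sine_mode n z)"
      unfolding sine_poly_def by blast
    with p(2) have "integral {0..1} (\<lambda>z. (f z - (\<Sum>n<N. b n * sine_mode n z))\<^sup>2) < e"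
      by simp
    moreover have "0 \<le> (\<Sum>n<N. (b n - sine_coeff f n)\<^sup>2) / 2"
      by (intro divide_nonneg_nonneg sum_nonneg) auto
    ultimately have N: "?I - ?S N < e" unfolding err by linarith
    have "norm (?S M - ?I) < e" if "N \<le> M" for M
    proof -
      have "?S N \<le> ?S M" using that by (intro sum_mono2) auto
      then show ?thesis using N bessel[of M] by simp
    qed
    then show "\<exists>N. \<forall>M\<ge>N. norm (?S M - ?I) < e" by blast
  qed
  then show ?thesis by (simp add: sums_def)
qed

lemma sine_coeff_diff:
  assumes "continuous_on {0..1} f" "continuous_on {0..1} g"
  shows "sine_coeff (\<lambda>z. f z - g z) n = sine_coeff f n - sine_coeff g n"
  unfolding sine_coeff_def left_diff_distrib
  by (subst integral_diff) (auto intro!: integrable_mult_sine_mode assms)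

text \<open>Parseval's identity for f - g gives a vanishing integral of its square, and continuity
  turns this into equality at every point, endpoints included.\<close>

lemma sine_coeff_inject:
  assumes f: "continuous_on {0..1} f" and g: "continuous_on {0..1} g"
    and eq: "\<And>n. sine_coeff f n = sine_coeff g n" and z: "z \<in> {0..1}"
  shows "f z = g z"
proof -
  have cont: "continuous_on {0..1} (\<lambda>z. f z - g z)"
    by (intro continuous_intros f g)
  have "(\<lambda>n. 0) sums integral {0..1} (\<lambda>z. (f z - g z)\<^sup>2)"
    using sine_parseval[OF cont] by (simp add: sine_coeff_diff[OF f g] eq)
  then have "integral {0..1} (\<lambda>z. (f z - g z)\<^sup>2) = 0"
    by (simp add: sums_iff)
  then have "((\<lambda>z. (f z - g z)\<^sup>2) has_integral 0) (cbox 0 1)"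
    using integrable_integral[OF integrable_continuous_real[OF continuous_on_power[OF cont, of 2]]]
    by simp
  then have "(f z - g z)\<^sup>2 = 0"
    by (rule has_integral_0_cbox_imp_0[rotated 2])
       (use z in \<open>auto intro!: continuous_intros f g\<close>)
  then show ?thesis by simp
qed

section \<open>Regularity and decay of sine coefficients\<close>

lemma has_real_derivative_blinfunI:
  assumes "(f has_derivative blinfun_apply L) (at x within S)"
  shows "(f has_real_derivative blinfun_apply L 1) (at x within S)"
proof -
  have "blinfun_apply L = (*) (blinfun_apply L 1)"
  proof
    fix h :: real
    have "blinfun_apply L (h *\<^sub>R 1) = h *\<^sub>R blinfun_apply L 1" by (rule blinfun.scaleR_right)
    then show "blinfun_apply L h = blinfun_apply L 1 * h" by simp
  qed
  with assms show ?thesis by (simp add: has_field_derivative_def)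
qed

text \<open>A linear map on the reals is multiplication by its value at 1. The second derivative is
  a map into linear maps, so it is evaluated at 1 twice.\<close>

lemma C2_on_realE:
  fixes f :: "real \<Rightarrow> real"
  assumes "C2_on S f"
  obtains f1 f2 where
    "\<And>x. x \<in> S \<Longrightarrow> (f has_real_derivative f1 x) (at x within S)"
    "\<And>x. x \<in> S \<Longrightarrow> (f1 has_real_derivative f2 x) (at x within S)"
    "continuous_on S f2"
proof -
  obtain f' :: "real \<Rightarrow> real \<Rightarrow>\<^sub>L real" and f'' :: "real \<Rightarrow> real \<Rightarrow>\<^sub>L real \<Rightarrow>\<^sub>L real" where
      f': "\<And>x. x \<in> S \<Longrightarrow> (f has_derivative f' x) (at x within S)"
      and f'': "\<And>x. x \<in> S \<Longrightarrow> (f' has_derivative f'' x) (at x within S)"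
      and cont: "continuous_on S f''"
    using assms unfolding C2_on_def C1_on_def by blast
  show thesis
  proof (rule that)
    show "(f has_real_derivative blinfun_apply (f' x) 1) (at x within S)" if "x \<in> S" for x
      using has_real_derivative_blinfunI[OF f'[OF that]] .
    show "((\<lambda>x. blinfun_apply (f' x) 1) has_real_derivative
        blinfun_apply (blinfun_apply (f'' x) 1) 1) (at x within S)" if "x \<in> S" for x
    proof -
      have "((\<lambda>x. blinfun_apply (f' x) 1) has_derivative (\<lambda>h. blinfun_apply (f'' x h) 1)) (at x within S)"
        by (rule bounded_linear.has_derivative[OF blinfun.bounded_linear_left f''[OF that]])
      moreover have "(\<lambda>h. blinfun_apply (f'' x h) 1) = (*) (blinfun_apply (blinfun_apply (f'' x) 1) 1)"
      proof
        fix h :: real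
        have "blinfun_apply (f'' x) h = h *\<^sub>R blinfun_apply (f'' x) 1"
          using blinfun.scaleR_right[of "f'' x" h 1] by (simp only: real_scaleR_def mult_1_right)
        then show "blinfun_apply (f'' x h) 1 = blinfun_apply (blinfun_apply (f'' x) 1) 1 * h"
          by (simp only: blinfun.scaleR_left real_scaleR_def mult.commute)
      qed
      ultimately show ?thesis by (simp only: has_field_derivative_def)
    qed
    show "continuous_on S (\<lambda>x. blinfun_apply (blinfun_apply (f'' x) 1) 1)"
      by (rule blinfun.continuous_on[OF blinfun.continuous_on[OF cont continuous_on_const] continuous_on_const])
  qed
qed

lemma C2_on_realI:
  fixes f :: "real \<Rightarrow> real"
  assumes f1: "\<And>x. x \<in> S \<Longrightarrow> (f has_real_derivative f1 x) (at x within S)"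
    and f2: "\<And>x. x \<in> S \<Longrightarrow> (f1 has_real_derivative f2 x) (at x within S)"
    and cont: "continuous_on S f2"
  shows "C2_on S f"
proof -
  note bl = bounded_linear_blinfun_scaleR_left
  have *: "blinfun_apply (blinfun_scaleR_left a) = (*) a" for a :: real
    by (auto simp: fun_eq_iff)
  let ?f' = "\<lambda>x. blinfun_scaleR_left (f1 x)"
  let ?f'' = "\<lambda>x. blinfun_scaleR_left (blinfun_scaleR_left (f2 x))"
  have "(f has_derivative blinfun_apply (?f' x)) (at x within S)" if "x \<in> S" for x
    using f1[OF that] unfolding has_field_derivative_def * .
  moreover have "(?f' has_derivative blinfun_apply (?f'' x)) (at x within S)" if "x \<in> S" for x
  proof -
    have "(?f' has_derivative (\<lambda>h. blinfun_scaleR_left (f2 x * h))) (at x within S)"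
      using bounded_linear.has_derivative[OF bl f2[OF that, unfolded has_field_derivative_def]] .
    moreover have "(\<lambda>h. blinfun_scaleR_left (f2 x * h)) = blinfun_apply (?f'' x)"
      by (auto intro!: ext blinfun_eqI simp: blinfun.scaleR_left)
    ultimately show ?thesis by simp
  qed
  moreover have "continuous_on S ?f''"
    by (intro bounded_linear.continuous_on[OF bl] cont)
  ultimately show ?thesis
    unfolding C2_on_def C1_on_def by (intro exI[of _ ?f'] exI[of _ ?f''] conjI ballI)
qed

lemma C2_on_imp_continuous_on:
  assumes "C2_on S f"
  shows "continuous_on S f"
proof -
  obtain f' where "\<And>x. x \<in> S \<Longrightarrow> (f has_derivative blinfun_apply (f' x)) (at x within S)"
    using assms unfolding C2_on_def by blast
  then show ?thesis by (rule has_derivative_continuous_on)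
qed

lemma C2_on_cong:
  assumes "\<And>x. x \<in> S \<Longrightarrow> f x = g x"
  shows "C2_on S f \<longleftrightarrow> C2_on S g"
proof -
  have "(f has_derivative L) (at x within S) \<longleftrightarrow> (g has_derivative L) (at x within S)"
    if "x \<in> S" for x L
    using has_derivative_transform[OF that, of f g] has_derivative_transform[OF that, of g f] assms by auto
  then show ?thesis unfolding C2_on_def by (simp cong: conj_cong ball_cong)
qed

lemma freq_neq_0 [simp]: "freq n \<noteq> 0"
  using freq_pos[of n] by linarith

text \<open>The total derivative is restricted to a line of constant z and evaluated at (1, 0).
  Openness of \<open>S\<close> makes the time derivative two-sided, while \<open>T\<close> may be
  the closed space interval.\<close>

lemma C1_on_prod_partial_fst:
  fixes u :: "real \<Rightarrow> real \<Rightarrow> real"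
  assumes u: "C1_on (S \<times> T) (\<lambda>(t, z). u t z)" and "open S"
  obtains ut :: "real \<Rightarrow> real \<Rightarrow> real" where
    "\<And>t z. t \<in> S \<Longrightarrow> z \<in> T \<Longrightarrow> ((\<lambda>\<tau>. u \<tau> z) has_real_derivative ut t z) (at t)"
    "continuous_on (S \<times> T) (\<lambda>(t, z). ut t z)"
proof -
  obtain u' :: "real \<times> real \<Rightarrow> (real \<times> real) \<Rightarrow>\<^sub>L real" where
      u': "\<And>x. x \<in> S \<times> T \<Longrightarrow> ((\<lambda>(t, z). u t z) has_derivative u' x) (at x within S \<times> T)"
      and cont: "continuous_on (S \<times> T) u'"
    using u unfolding C1_on_def by metis
  show thesis
  proof (rule that)
    show "((\<lambda>\<tau>. u \<tau> z) has_real_derivative blinfun_apply (u' (t, z)) (1, 0)) (at t)"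
      if tz: "t \<in> S" "z \<in> T" for t z
    proof -
      have pair: "((\<lambda>\<tau>. (\<tau>, z)) has_derivative (\<lambda>h. (h, 0))) (at t within S)"
        by (auto intro!: derivative_eq_intros)
      have "((\<lambda>(t, z). u t z) has_derivative u' (t, z)) (at (t, z) within (\<lambda>\<tau>. (\<tau>, z)) ` S)"
        using u'[of "(t, z)"] tz by (auto intro: has_derivative_subset)
      from diff_chain_within[OF pair this]
      have "((\<lambda>\<tau>. u \<tau> z) has_derivative (\<lambda>h. blinfun_apply (u' (t, z)) (h, 0))) (at t)"
        by (simp add: o_def at_within_open[OF tz(1) \<open>open S\<close>])
      moreover have "(\<lambda>h. blinfun_apply (u' (t, z)) (h, 0)) = (*) (blinfun_apply (u' (t, z)) (1, 0))"
      proof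
        fix h :: real
        show "blinfun_apply (u' (t, z)) (h, 0) = blinfun_apply (u' (t, z)) (1, 0) * h"
          using blinfun.scaleR_right[of "u' (t, z)" h "(1, 0)"]
          by (simp only: scaleR_Pair real_scaleR_def mult_1_left mult_zero_left mult_1_right mult_zero_right mult.commute)
      qed
      ultimately show ?thesis by (simp only: has_field_derivative_def)
    qed
    show "continuous_on (S \<times> T) (\<lambda>(t, z). blinfun_apply (u' (t, z)) (1, 0))"
      using bounded_linear.continuous_on[OF blinfun.bounded_linear_left cont]
      by (simp add: case_prod_beta')
  qed
qed

text \<open>Continuous partial derivatives give a total derivative. Continuity of the z-derivative
  provides differentiability, and that of the t-derivative completes the continuity of the total
  derivative.\<close>

lemma C1_on_prodI:
  fixes u :: "real \<Rightarrow> real \<Rightarrow> real"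
  assumes ut: "\<And>t z. t \<in> S \<Longrightarrow> z \<in> T \<Longrightarrow> ((\<lambda>\<tau>. u \<tau> z) has_real_derivative ut t z) (at t within S)"
    and uz: "\<And>t z. t \<in> S \<Longrightarrow> z \<in> T \<Longrightarrow> (u t has_real_derivative uz t z) (at z within T)"
    and cont_t: "continuous_on (S \<times> T) (\<lambda>(t, z). ut t z)"
    and cont_z: "continuous_on (S \<times> T) (\<lambda>(t, z). uz t z)"
    and "convex T"
  shows "C1_on (S \<times> T) (\<lambda>(t, z). u t z)"
proof -
  note bl = bounded_linear_blinfun_scaleR_left
  have *: "blinfun_apply (blinfun_scaleR_left a) = (*) a" for a :: real
    by (auto simp: fun_eq_iff)
  define u' :: "real \<times> real \<Rightarrow> (real \<times> real) \<Rightarrow>\<^sub>L real" where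
    "u' p = ut (fst p) (snd p) *\<^sub>R fst_blinfun + uz (fst p) (snd p) *\<^sub>R snd_blinfun" for p
  have "((\<lambda>(t, z). u t z) has_derivative u' (t, z)) (at (t, z) within S \<times> T)"
    if tz: "t \<in> S" "z \<in> T" for t z
  proof -
    have "continuous_on (S \<times> T) (\<lambda>(t, z). blinfun_scaleR_left (uz t z))"
      using bounded_linear.continuous_on[OF bl cont_z] by (simp add: case_prod_beta')
    then have "continuous (at (t, z) within S \<times> T) (\<lambda>(t, z). blinfun_scaleR_left (uz t z))"
      using tz by (auto simp: continuous_on_eq_continuous_within)
    then have "((\<lambda>(t, z). u t z) has_derivative
        (\<lambda>(ht, hz). ut t z * ht + blinfun_scaleR_left (uz t z) hz)) (at (t, z) within S \<times> T)"
      by (intro has_derivative_partialsI)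
         (use ut uz tz \<open>convex T\<close> in \<open>auto simp only: * has_field_derivative_def\<close>)
    also have "(\<lambda>(ht, hz). ut t z * ht + blinfun_scaleR_left (uz t z) hz) = blinfun_apply (u' (t, z))"
      by (auto simp: u'_def fun_eq_iff blinfun.add_left blinfun.scaleR_left)
    finally show ?thesis .
  qed
  moreover have "continuous_on (S \<times> T) u'"
    unfolding u'_def using cont_t cont_z
    by (intro continuous_intros) (auto simp: case_prod_beta')
  ultimately show ?thesis unfolding C1_on_def by auto
qed

text \<open>Two integrations by parts at once, with antiderivative g' sin - w g cos. The sine
  vanishes at both ends, so g' disappears and only the boundary values of g survive. This is the
  source of the forcing term in the mode equations, and of quadratic decay when those values are
  zero.\<close>

lemma sine_coeff_second_derivative:
  assumes g1: "\<And>z. z \<in> {0..1} \<Longrightarrow> (g has_real_derivative g1 z) (at z within {0..1})"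
    and g2: "\<And>z. z \<in> {0..1} \<Longrightarrow> (g1 has_real_derivative g2 z) (at z within {0..1})"
    and cont: "continuous_on {0..1} g2"
  shows "sine_coeff g2 n = 2 * freq n * (g 0 - g 1 * cos (freq n)) - (freq n)\<^sup>2 * sine_coeff g n"
proof -
  let ?w = "freq n"
  have g: "continuous_on {0..1} g" using g1 by (rule DERIV_continuous_on)
  have A: "((\<lambda>z. g2 z * sine_mode n z + ?w\<^sup>2 * (g z * sine_mode n z)) has_integral
      (g1 1 * sin (?w * 1) - ?w * g 1 * cos (?w * 1)) - (g1 0 * sin (?w * 0) - ?w * g 0 * cos (?w * 0))) {0..1}"
  proof (rule fundamental_theorem_of_calculus)
    fix z :: real assume z: "z \<in> {0..1}"
    have "((\<lambda>z. g1 z * sin (?w * z) - ?w * g z * cos (?w * z)) has_real_derivative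
        g2 z * sine_mode n z + ?w\<^sup>2 * (g z * sine_mode n z)) (at z within {0..1})"
      by (rule derivative_eq_intros refl g1[OF z] g2[OF z])+
         (simp add: sine_mode_def power2_eq_square)
    then show "((\<lambda>z. g1 z * sin (?w * z) - ?w * g z * cos (?w * z)) has_vector_derivative
        g2 z * sine_mode n z + ?w\<^sup>2 * (g z * sine_mode n z)) (at z within {0..1})"
      by (simp add: has_real_derivative_iff_has_vector_derivative)
  qed simp
  have B: "((\<lambda>z. g2 z * sine_mode n z + ?w\<^sup>2 * (g z * sine_mode n z)) has_integral
      sine_coeff g2 n / 2 + ?w\<^sup>2 * (sine_coeff g n / 2)) {0..1}"
    by (intro has_integral_add has_integral_mult_right has_integral_sine_coeff g cont)
  show ?thesis
    using has_integral_unique[OF A B] by (simp add: field_simps)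
qed

lemma abs_sine_coeff_le:
  assumes "continuous_on {0..1} f" "\<And>z. z \<in> {0..1} \<Longrightarrow> \<bar>f z\<bar> \<le> K"
  shows "\<bar>sine_coeff f n\<bar> \<le> 2 * K"
proof -
  have "norm (integral {0..1} (\<lambda>z. f z * sine_mode n z)) \<le> integral {0..1} (\<lambda>z::real. K)"
  proof (rule integral_norm_bound_integral)
    show "norm (f z * sine_mode n z) \<le> K" if "z \<in> {0..1}" for z
      using mult_mono[OF assms(2)[OF that] abs_sine_mode_le_1[of n z]] assms(2)[OF that]
      by (simp add: abs_mult)
  qed (use integrable_mult_sine_mode[OF assms(1)] in auto)
  then show ?thesis by (simp add: sine_coeff_def abs_mult)
qed

lemma summable_inverse_freq_sq: "summable (\<lambda>n. 1 / (freq n)\<^sup>2)"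
proof -
  have "summable (\<lambda>n. 1 / pi\<^sup>2 * (1 / (real (Suc n))\<^sup>2))"
    using inverse_squares_sums by (intro summable_mult) (auto simp: sums_iff)
  then show ?thesis by (simp add: freq_def power_mult_distrib mult.commute)
qed

text \<open>With zero boundary values the coefficient is -1 / w^2 times a coefficient of the bounded
  function g'', so the series is dominated by the inverse squares.\<close>

lemma summable_sine_coeff:
  assumes "C2_on {0..1} g" "g 0 = 0" "g 1 = 0"
  shows "summable (\<lambda>n. \<bar>sine_coeff g n\<bar>)"
proof -
  obtain g1 g2 where g:
      "\<And>z. z \<in> {0..1} \<Longrightarrow> (g has_real_derivative g1 z) (at z within {0..1})"
      "\<And>z. z \<in> {0..1} \<Longrightarrow> (g1 has_real_derivative g2 z) (at z within {0..1})"
      "continuous_on {0..1} g2"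
    using C2_on_realE[OF assms(1)] by metis
  have "bounded (g2 ` {0..1})"
    by (intro compact_imp_bounded compact_continuous_image g(3)) auto
  then obtain K where K: "\<And>z. z \<in> {0..1} \<Longrightarrow> \<bar>g2 z\<bar> \<le> K"
    unfolding bounded_iff by (metis image_eqI real_norm_def)
  have bound: "\<bar>sine_coeff g n\<bar> \<le> 2 * K * (1 / (freq n)\<^sup>2)" for n
  proof -
    have "(freq n)\<^sup>2 * \<bar>sine_coeff g n\<bar> = \<bar>sine_coeff g2 n\<bar>"
      using sine_coeff_second_derivative[OF g, of n] assms(2,3) by (simp add: abs_mult)
    also have "\<dots> \<le> 2 * K" by (rule abs_sine_coeff_le[OF g(3) K])
    finally show ?thesis using freq_pos[of n] by (simp add: pos_le_divide_eq mult.commute)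
  qed
  show ?thesis
    by (rule summable_comparison_test'[OF summable_mult[OF summable_inverse_freq_sq], of 0 _ "2 * K"])
       (use bound in auto)
qed

lemma sine_series_cont:
  assumes "summable (\<lambda>n. \<bar>a n\<bar>)"
  shows "uniform_limit UNIV (\<lambda>N z. \<Sum>n<N. a n * sine_mode n z) (\<lambda>z. \<Sum>n. a n * sine_mode n z) sequentially"
    and "continuous_on S (\<lambda>z. \<Sum>n. a n * sine_mode n z)"
proof -
  show *: "uniform_limit UNIV (\<lambda>N z. \<Sum>n<N. a n * sine_mode n z) (\<lambda>z. \<Sum>n. a n * sine_mode n z) sequentially"
    by (rule Weierstrass_m_test[OF _ assms]) (simp add: abs_mult mult_left_le)
  have "continuous_on UNIV (\<lambda>z. \<Sum>n. a n * sine_mode n z)"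
    by (rule uniform_limit_theorem[OF _ *]) (auto intro!: always_eventually continuous_intros)
  then show "continuous_on S (\<lambda>z. \<Sum>n. a n * sine_mode n z)"
    by (rule continuous_on_subset) simp
qed

text \<open>Uniform convergence allows integration to pass to the limit, and by orthogonality the
  integrals of the partial sums are constant from N = m + 1 on.\<close>

lemma sine_coeff_series:
  assumes a: "summable (\<lambda>n. \<bar>a n\<bar>)"
  shows "sine_coeff (\<lambda>z. \<Sum>n. a n * sine_mode n z) m = a m"
proof -
  let ?p = "\<lambda>N z. \<Sum>n<N. a n * sine_mode n z"
  have "uniform_limit {0..1} (\<lambda>N z. ?p N z * sine_mode m z)
      (\<lambda>z. (\<Sum>n. a n * sine_mode n z) * sine_mode m z) sequentially"
  proof (rule uniform_lim_mult)
    show "uniform_limit {0..1} ?p (\<lambda>z. \<Sum>n. a n * sine_mode n z) sequentially"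
      using sine_series_cont(1)[OF a] by (rule uniform_limit_on_subset) simp
    show "bounded ((\<lambda>z. \<Sum>n. a n * sine_mode n z) ` {0..1})"
      by (intro compact_imp_bounded compact_continuous_image sine_series_cont(2) a) auto
    show "bounded (sine_mode m ` {0..1})"
      by (intro compact_imp_bounded compact_continuous_image continuous_intros) auto
  qed (rule uniform_limit_const)
  then obtain I J where
      I: "\<And>N. ((\<lambda>z. ?p N z * sine_mode m z) has_integral I N) {0..1}"
      and J: "((\<lambda>z. (\<Sum>n. a n * sine_mode n z) * sine_mode m z) has_integral J) {0..1}"
      and lim: "I \<longlonglongrightarrow> J"
    by (rule uniform_limit_integral) (auto intro!: continuous_intros)
  have "I N = a m / 2" if "m < N" for N
  proof -
    have "((\<lambda>z. \<Sum>n<N. a n * (sine_mode n z * sine_mode m z)) has_integral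
        (\<Sum>n<N. a n * (if n = m then 1/2 else 0))) {0..1}"
      by (intro has_integral_sum has_integral_mult_right sine_mode_orthogonal) auto
    then have "((\<lambda>z. ?p N z * sine_mode m z) has_integral a m / 2) {0..1}"
      using that by (simp add: sum_distrib_right mult.assoc if_distrib cong: if_cong)
    then show ?thesis using I has_integral_unique by blast
  qed
  then have "\<forall>\<^sub>F N in sequentially. I N = a m / 2"
    by (auto simp: eventually_at_top_dense)
  then have "I \<longlonglongrightarrow> a m / 2" by (rule tendsto_eventually)
  then have "J = a m / 2" using lim LIMSEQ_unique by blast
  then show ?thesis using integral_unique[OF J] by (simp add: sine_coeff_def)
qed

text \<open>Both sides are continuous and have the same sine coefficients, so completeness
  identifies them; no pointwise Fourier convergence theorem enters.\<close>

lemma sine_series_eq: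
  assumes g: "C2_on {0..1} g" "g 0 = 0" "g 1 = 0" and z: "z \<in> {0..1}"
  shows "(\<Sum>n. sine_coeff g n * sine_mode n z) = g z"
proof (rule sine_coeff_inject[OF _ _ _ z])
  show "continuous_on {0..1} (\<lambda>z. \<Sum>n. sine_coeff g n * sine_mode n z)"
    by (intro sine_series_cont summable_sine_coeff g)
  show "continuous_on {0..1} g" by (rule C2_on_imp_continuous_on[OF g(1)])
  show "sine_coeff (\<lambda>z. \<Sum>n. sine_coeff g n * sine_mode n z) n = sine_coeff g n" for n
    by (intro sine_coeff_series summable_sine_coeff g)
qed

section \<open>Solutions of the target problem in sine coefficients\<close>

text \<open>Projecting the equation on \<open>sin (n\<pi>z)\<close> decouples it; the boundary value enters through the
  integration by parts.\<close>

lemma dirichlet_solution_sine_coeff: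
  assumes u: "dirichlet_solution D r b u"
  shows "continuous_on {0..} (\<lambda>t. sine_coeff (u t) n)"
    and "\<And>t. 0 < t \<Longrightarrow> ((\<lambda>t. sine_coeff (u t) n) has_real_derivative
      (r - D * (freq n)\<^sup>2) * sine_coeff (u t) n + 2 * D * freq n * b t) (at t)"
proof -
  have cont: "continuous_on ({0..} \<times> {0..1}) (\<lambda>(t, z). u t z)"
    and C1: "C1_on ({0<..} \<times> {0..1}) (\<lambda>(t, z). u t z)"
    and C2: "\<And>t. 0 \<le> t \<Longrightarrow> C2_on {0..1} (u t)"
    and pde: "\<And>t z. 0 < t \<Longrightarrow> z \<in> {0<..<1} \<Longrightarrow>
      deriv (\<lambda>\<tau>. u \<tau> z) t = D * deriv (deriv (u t)) z + r * u t z"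
    and bc: "\<And>t. 0 \<le> t \<Longrightarrow> u t 0 = b t \<and> u t 1 = 0"
    using u unfolding dirichlet_solution_def by auto
  have cont_mode: "continuous_on ({0..} \<times> cbox 0 1) (\<lambda>(t, z). u t z * sine_mode n z)"
    using cont by (auto simp: case_prod_beta' intro!: continuous_intros)
  have "continuous_on {0..} (\<lambda>t. 2 * integral (cbox 0 1) (\<lambda>z. u t z * sine_mode n z))"
    by (intro continuous_intros integral_continuous_on_param cont_mode)
  then show "continuous_on {0..} (\<lambda>t. sine_coeff (u t) n)"
    by (simp add: sine_coeff_def)
  obtain ut where ut: "\<And>t z. t \<in> {0<..} \<Longrightarrow> z \<in> {0..1} \<Longrightarrow>
        ((\<lambda>\<tau>. u \<tau> z) has_real_derivative ut t z) (at t)"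
      and cont_ut: "continuous_on ({0<..} \<times> {0..1}) (\<lambda>(t, z). ut t z)"
    using C1_on_prod_partial_fst[OF C1 open_greaterThan] by metis
  fix t :: real assume t: "0 < t"
  obtain g1 g2 where
      g1: "\<And>z. z \<in> {0..1} \<Longrightarrow> (u t has_real_derivative g1 z) (at z within {0..1})"
      and g2: "\<And>z. z \<in> {0..1} \<Longrightarrow> (g1 has_real_derivative g2 z) (at z within {0..1})"
      and cont_g2: "continuous_on {0..1} g2"
    using C2_on_realE[OF C2[of t]] t by (metis less_imp_le)
  have cont_u: "continuous_on {0..1} (u t)"
    using g1 by (rule DERIV_continuous_on)
  \<comment> \<open>The C^2 condition speaks of derivatives within the closed interval, the equation
    of the two-sided \<open>deriv\<close>. They coincide in the interior, so the equation is
    translated to \<open>g2\<close> there.\<close>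
  have interior: "at z within {0..1} = at z" if "z \<in> {0<..<1}" for z :: real
    using that by (intro at_within_interior) auto
  have "deriv (u t) z = g1 z" if "z \<in> {0<..<1}" for z
    using g1[of z] that by (intro DERIV_imp_deriv) (auto simp: interior)
  moreover have "(g1 has_real_derivative g2 z) (at z)" if "z \<in> {0<..<1}" for z
    using g2[of z] that by (auto simp: interior)
  ultimately have "(deriv (u t) has_real_derivative g2 z) (at z)" if "z \<in> {0<..<1}" for z
    using that by (intro has_field_derivative_transform_within_open[of g1 _ _ "{0<..<1}" "deriv (u t)"]) auto
  then have ut_eq: "ut t z = D * g2 z + r * u t z" if "z \<in> {0<..<1}" for z
    using pde[OF t that] DERIV_imp_deriv[OF ut[of t z]] DERIV_imp_deriv[of "deriv (u t)" "g2 z" z] t that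
    by auto
  have "((\<lambda>t. integral (cbox 0 1) (\<lambda>z. u t z * sine_mode n z)) has_real_derivative
      integral (cbox 0 1) (\<lambda>z. ut t z * sine_mode n z)) (at t within {0<..})"
  proof (rule leibniz_rule_field_derivative)
    show "((\<lambda>t. u t z * sine_mode n z) has_real_derivative ut s z * sine_mode n z) (at s within {0<..})"
      if "s \<in> {0<..}" "z \<in> cbox 0 1" for s z
      using ut[of s z] that by (intro DERIV_cmult_right) (auto intro: has_field_derivative_at_within)
    show "(\<lambda>z. u s z * sine_mode n z) integrable_on cbox 0 1" if "s \<in> {0<..}" for s
      using integrable_mult_sine_mode[OF C2_on_imp_continuous_on[OF C2]] that by simp
    show "continuous_on ({0<..} \<times> cbox 0 1) (\<lambda>(s, z). ut s z * sine_mode n z)"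
      using cont_ut by (auto simp: case_prod_beta' intro!: continuous_intros)
  qed (use t in auto)
  then have "((\<lambda>t. sine_coeff (u t) n) has_real_derivative sine_coeff (ut t) n) (at t)"
    unfolding sine_coeff_def
    by (intro DERIV_cmult) (simp add: at_within_open[of t "{0<..}"] t)
  also have "sine_coeff (ut t) n = D * sine_coeff g2 n + r * sine_coeff (u t) n"
  proof -
    have "((\<lambda>z. D * (g2 z * sine_mode n z) + r * (u t z * sine_mode n z)) has_integral
        D * (sine_coeff g2 n / 2) + r * (sine_coeff (u t) n / 2)) {0..1}"
      by (intro has_integral_add has_integral_mult_right has_integral_sine_coeff cont_u cont_g2)
    \<comment> \<open>The equation is available only in the interior; at the two endpoints both
      sides vanish because the mode does.\<close>
    moreover have "D * (g2 z * sine_mode n z) + r * (u t z * sine_mode n z) = ut t z * sine_mode n z"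
      if "z \<in> {0..1}" for z
    proof (cases "z \<in> {0<..<1}")
      case True
      show ?thesis unfolding ut_eq[OF True] by (simp add: algebra_simps)
    next
      case False
      then have "z = 0 \<or> z = 1" using that by auto
      then show ?thesis by auto
    qed
    ultimately have "((\<lambda>z. ut t z * sine_mode n z) has_integral
        D * (sine_coeff g2 n / 2) + r * (sine_coeff (u t) n / 2)) {0..1}"
      by (rule has_integral_eq[rotated])
    then show ?thesis
      unfolding sine_coeff_def[of "ut t"] by (simp add: integral_unique field_simps)
  qed
  also have "sine_coeff g2 n = 2 * freq n * b t - (freq n)\<^sup>2 * sine_coeff (u t) n"
    using sine_coeff_second_derivative[OF g1 g2 cont_g2, of n] bc[of t] t by simp
  also have "D * (2 * freq n * b t - (freq n)\<^sup>2 * sine_coeff (u t) n) + r * sine_coeff (u t) n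
      = (r - D * (freq n)\<^sup>2) * sine_coeff (u t) n + 2 * D * freq n * b t"
    by (simp add: algebra_simps)
  finally show "((\<lambda>t. sine_coeff (u t) n) has_real_derivative
      (r - D * (freq n)\<^sup>2) * sine_coeff (u t) n + 2 * D * freq n * b t) (at t)" .
qed

text \<open>Variation of constants as a monotonicity argument. For a sign \<sigma>, the function
  \<kappa> M / \<mu> e^(\<mu> s) - e^(\<mu> s) \<sigma> a(s) has derivative e^(\<mu> s) \<kappa> (M
  - \<sigma> b(s)) \<ge> 0. This uses derivatives only at positive times, which is what solutions
  offer, and the two signs together bound the absolute value.\<close>

lemma linear_ode_bound:
  fixes a b :: "real \<Rightarrow> real"
  assumes cont: "continuous_on {0..t} a"
    and deriv: "\<And>s. 0 < s \<Longrightarrow> s < t \<Longrightarrow> (a has_real_derivative - \<mu> * a s + \<kappa> * b s) (at s)"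
    and b: "\<And>s. 0 < s \<Longrightarrow> s < t \<Longrightarrow> \<bar>b s\<bar> \<le> M"
    and "0 \<le> t" "0 < \<mu>" "0 \<le> \<kappa>" "0 \<le> M"
  shows "\<bar>a t\<bar> \<le> exp (- \<mu> * t) * \<bar>a 0\<bar> + \<kappa> / \<mu> * M"
proof -
  have *: "exp (\<mu> * t) * (\<sigma> * a t) - \<sigma> * a 0 \<le> \<kappa> * M / \<mu> * exp (\<mu> * t) - \<kappa> * M / \<mu>"
    if \<sigma>: "\<sigma> = 1 \<or> \<sigma> = -1" for \<sigma> :: real
  proof -
    define h where "h s = \<kappa> * M / \<mu> * exp (\<mu> * s) - exp (\<mu> * s) * (\<sigma> * a s)" for s
    have "h 0 \<le> h t"
    proof (rule DERIV_nonneg_imp_increasing_open[OF \<open>0 \<le> t\<close>])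
      fix s assume s: "0 < s" "s < t"
      have "(h has_real_derivative \<kappa> * M / \<mu> * (exp (\<mu> * s) * \<mu>)
          - (exp (\<mu> * s) * \<mu> * (\<sigma> * a s) + exp (\<mu> * s) * (\<sigma> * (- \<mu> * a s + \<kappa> * b s)))) (at s)"
        unfolding h_def
        by (rule derivative_eq_intros refl deriv[OF s])+ (simp add: algebra_simps)
      moreover have "\<kappa> * M / \<mu> * (exp (\<mu> * s) * \<mu>)
          - (exp (\<mu> * s) * \<mu> * (\<sigma> * a s) + exp (\<mu> * s) * (\<sigma> * (- \<mu> * a s + \<kappa> * b s)))
          = exp (\<mu> * s) * (\<kappa> * (M - \<sigma> * b s))"
        using \<open>0 < \<mu>\<close> by (simp add: field_simps)
      moreover have "0 \<le> exp (\<mu> * s) * (\<kappa> * (M - \<sigma> * b s))"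
        using b[OF s] \<sigma> \<open>0 \<le> \<kappa>\<close> by (intro mult_nonneg_nonneg) auto
      ultimately show "\<exists>y. DERIV h s :> y \<and> 0 \<le> y" by auto
    next
      show "continuous_on {0..t} h"
        unfolding h_def by (intro continuous_intros cont)
    qed
    then show ?thesis by (simp add: h_def algebra_simps)
  qed
  have "exp (\<mu> * t) * \<bar>a t\<bar> \<le> \<bar>a 0\<bar> + \<kappa> * M / \<mu> * exp (\<mu> * t) - \<kappa> * M / \<mu>"
    using *[of 1] *[of "-1"] by (cases "0 \<le> a t") auto
  \<comment> \<open>The sharper bound has a factor 1 - e^(-\<mu> t) on the forcing; dropping the
    negative term makes the forcing contribution independent of t.\<close>
  moreover have "0 \<le> \<kappa> * M / \<mu>" using assms by auto
  ultimately have "exp (\<mu> * t) * \<bar>a t\<bar> \<le> \<bar>a 0\<bar> + \<kappa> * M / \<mu> * exp (\<mu> * t)" by linarith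
  then have "exp (- \<mu> * t) * (exp (\<mu> * t) * \<bar>a t\<bar>) \<le> exp (- \<mu> * t) * (\<bar>a 0\<bar> + \<kappa> * M / \<mu> * exp (\<mu> * t))"
    by (intro mult_left_mono) auto
  then show ?thesis by (simp add: exp_minus field_simps)
qed

text \<open>The boundary terms cancel in the difference of two coefficients, leaving the homogeneous
  mode equation with zero initial value. This is \<open>linear_ode_bound\<close> with \<kappa>, b
  and M all zero.\<close>

lemma dirichlet_solution_unique:
  assumes u: "dirichlet_solution D (- c) b u" and v: "dirichlet_solution D (- c) b v"
    and "0 < D" "0 \<le> c" and init: "\<And>z. z \<in> {0..1} \<Longrightarrow> u 0 z = v 0 z"
    and t: "0 \<le> t" and z: "z \<in> {0..1}"
  shows "u t z = v t z"
proof (rule sine_coeff_inject[OF _ _ _ z])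
  show "continuous_on {0..1} (u t)" "continuous_on {0..1} (v t)"
    using u v t unfolding dirichlet_solution_def by (auto intro: C2_on_imp_continuous_on)
  fix n
  let ?a = "\<lambda>t. sine_coeff (u t) n - sine_coeff (v t) n" and ?\<mu> = "c + D * (freq n)\<^sup>2"
  have "\<bar>?a t\<bar> \<le> exp (- ?\<mu> * t) * \<bar>?a 0\<bar> + 0 / ?\<mu> * 0"
  proof (rule linear_ode_bound[where b = "\<lambda>_. 0"])
    show "continuous_on {0..t} ?a"
      by (intro continuous_intros continuous_on_subset[OF dirichlet_solution_sine_coeff(1)[OF u]]
          continuous_on_subset[OF dirichlet_solution_sine_coeff(1)[OF v]]) auto
    show "(?a has_real_derivative - ?\<mu> * ?a s + 0 * 0) (at s)" if "0 < s" "s < t" for s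
      using DERIV_diff[OF dirichlet_solution_sine_coeff(2)[OF u that(1)]
          dirichlet_solution_sine_coeff(2)[OF v that(1)], of n n]
      by (simp add: algebra_simps)
    show "0 < ?\<mu>" using \<open>0 < D\<close> \<open>0 \<le> c\<close> by (simp add: add_nonneg_pos)
  qed (use t in auto)
  moreover have "sine_coeff (u 0) n = sine_coeff (v 0) n"
    unfolding sine_coeff_def using init by (intro arg_cong[of _ _ "(*) 2"] integral_cong) auto
  ultimately show "sine_coeff (u t) n = sine_coeff (v t) n" by simp
qed

text \<open>Young's inequality: expand (\<epsilon> a - b)^2 / \<epsilon> \<ge> 0.\<close>

lemma power2_add_weighted:
  fixes a b \<epsilon> :: real
  assumes "0 < \<epsilon>"
  shows "(a + b)\<^sup>2 \<le> (1 + \<epsilon>) * a\<^sup>2 + (1 + inverse \<epsilon>) * b\<^sup>2"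
proof -
  have "0 \<le> (\<epsilon> * a - b)\<^sup>2 / \<epsilon>" using assms by simp
  then show ?thesis using assms by (simp add: power2_eq_square field_simps)
qed

text \<open>True for every f: when the square is not integrable, its integral has the default value
  0.\<close>

lemma L2_norm01_nonneg [simp]: "0 \<le> L2_norm01 f"
  by (cases "(\<lambda>z. (f z)\<^sup>2) integrable_on {0..1}")
     (auto simp: L2_norm01_def integral_nonneg not_integrable_integral)

text \<open>Here \<gamma> is kept abstract: the summands are half the squared steady responses of
  the modes to the constant boundary value 1. Young's inequality is applied mode by mode, so that
  both parts can be summed by square sums.\<close>

lemma dirichlet_solution_L2_bound:
  assumes u: "dirichlet_solution D (- c) d u" and "0 < D" "0 \<le> c" "0 < \<epsilon>" "0 \<le> t"
    and d: "\<And>s. s \<in> {0..t} \<Longrightarrow> \<bar>d s\<bar> \<le> M"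
    and gain: "(\<lambda>n. (2 * D * freq n / (c + D * (freq n)\<^sup>2))\<^sup>2 / 2) sums \<gamma>\<^sup>2" "0 \<le> \<gamma>"
  shows "L2_norm01 (u t) \<le> exp (- (c + D * pi\<^sup>2) * t) * L2_norm01 (u 0) * sqrt (1 + \<epsilon>)
           + sqrt (1 + inverse \<epsilon>) * \<gamma> * M"
proof -
  have M: "0 \<le> M" using d[of 0] \<open>0 \<le> t\<close> by auto
  let ?E = "exp (- (c + D * pi\<^sup>2) * t)"
  let ?\<mu> = "\<lambda>n. c + D * (freq n)\<^sup>2"
  have cont: "continuous_on {0..1} (u s)" if "0 \<le> s" for s
    using u that unfolding dirichlet_solution_def by (auto intro: C2_on_imp_continuous_on)
  have coeff: "(sine_coeff (u t) n)\<^sup>2 / 2 \<le> (1 + \<epsilon>) * ?E\<^sup>2 * ((sine_coeff (u 0) n)\<^sup>2 / 2)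
      + (1 + inverse \<epsilon>) * M\<^sup>2 * ((2 * D * freq n / ?\<mu> n)\<^sup>2 / 2)" for n
  proof -
    have \<mu>: "0 < ?\<mu> n" using \<open>0 < D\<close> \<open>0 \<le> c\<close> by (simp add: add_nonneg_pos)
    have "\<bar>sine_coeff (u t) n\<bar> \<le> exp (- ?\<mu> n * t) * \<bar>sine_coeff (u 0) n\<bar> + 2 * D * freq n / ?\<mu> n * M"
    proof (rule linear_ode_bound[where b = d])
      show "continuous_on {0..t} (\<lambda>t. sine_coeff (u t) n)"
        by (rule continuous_on_subset[OF dirichlet_solution_sine_coeff(1)[OF u]]) auto
      show "((\<lambda>t. sine_coeff (u t) n) has_real_derivative
          - ?\<mu> n * sine_coeff (u s) n + 2 * D * freq n * d s) (at s)" if "0 < s" for s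
        using dirichlet_solution_sine_coeff(2)[OF u that, of n] by (simp add: algebra_simps)
      show "0 \<le> 2 * D * freq n" using \<open>0 < D\<close> less_imp_le[OF freq_pos[of n]] by simp
    qed (use d \<open>0 \<le> t\<close> \<mu> M in auto)
    also have "\<dots> \<le> ?E * \<bar>sine_coeff (u 0) n\<bar> + 2 * D * freq n / ?\<mu> n * M"
    proof -
      \<comment> \<open>The lowest mode decays slowest; its rate c + D pi^2 serves for all of
        them.\<close>
      have "pi\<^sup>2 \<le> (freq n)\<^sup>2" using freq_ge_pi[of n] by (intro power_mono) auto
      then have "c + D * pi\<^sup>2 \<le> ?\<mu> n" using \<open>0 < D\<close> by simp
      then have "exp (- ?\<mu> n * t) \<le> ?E" using \<open>0 \<le> t\<close> by (simp add: mult_right_mono)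
      then show ?thesis by (simp add: mult_right_mono)
    qed
    finally have "(sine_coeff (u t) n)\<^sup>2 \<le> (?E * \<bar>sine_coeff (u 0) n\<bar> + 2 * D * freq n / ?\<mu> n * M)\<^sup>2"
      by (metis abs_ge_zero power2_abs power_mono)
    also have "\<dots> \<le> (1 + \<epsilon>) * (?E * \<bar>sine_coeff (u 0) n\<bar>)\<^sup>2 + (1 + inverse \<epsilon>) * (2 * D * freq n / ?\<mu> n * M)\<^sup>2"
      by (rule power2_add_weighted[OF \<open>0 < \<epsilon>\<close>])
    also have "\<dots> = (1 + \<epsilon>) * ?E\<^sup>2 * (sine_coeff (u 0) n)\<^sup>2
        + (1 + inverse \<epsilon>) * M\<^sup>2 * (2 * D * freq n / ?\<mu> n)\<^sup>2"
      unfolding power_mult_distrib power2_abs by (simp only: mult_ac)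
    finally show ?thesis by (simp add: field_simps)
  qed
  have "(L2_norm01 (u t))\<^sup>2 = integral {0..1} (\<lambda>z. (u t z)\<^sup>2)" if "0 \<le> t" for t
    unfolding L2_norm01_def
    by (intro real_sqrt_pow2 integral_nonneg integrable_continuous_real continuous_intros cont that) auto
  then have parseval: "(\<lambda>n. (sine_coeff (u s) n)\<^sup>2 / 2) sums (L2_norm01 (u s))\<^sup>2" if "0 \<le> s" for s
    using sine_parseval[OF cont[OF that]] that by simp
  have "(L2_norm01 (u t))\<^sup>2 \<le> (1 + \<epsilon>) * ?E\<^sup>2 * (L2_norm01 (u 0))\<^sup>2 + (1 + inverse \<epsilon>) * M\<^sup>2 * \<gamma>\<^sup>2"
    by (rule sums_le[OF coeff parseval[OF \<open>0 \<le> t\<close>]])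
       (intro sums_add sums_mult parseval gain order_refl)
  also have "\<dots> = (?E * L2_norm01 (u 0) * sqrt (1 + \<epsilon>))\<^sup>2 + (sqrt (1 + inverse \<epsilon>) * \<gamma> * M)\<^sup>2"
    using \<open>0 < \<epsilon>\<close> by (simp add: power_mult_distrib)
  \<comment> \<open>a^2 + b^2 \<le> (a + b)^2 for nonnegative a and b; only now, after summation, is
    the root split into two terms.\<close>
  also have "\<dots> \<le> (?E * L2_norm01 (u 0) * sqrt (1 + \<epsilon>) + sqrt (1 + inverse \<epsilon>) * \<gamma> * M)\<^sup>2"
    using \<open>0 < \<epsilon>\<close> gain(2) M by (simp add: power2_sum)
  finally show ?thesis
    by (rule power2_le_imp_le) (use \<open>0 < \<epsilon>\<close> gain(2) M in \<open>auto intro!: add_nonneg_nonneg\<close>)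
qed

text \<open>The gain is the \<open>L\<^sup>2\<close> norm of the stationary profile with boundary values \<open>1\<close> and \<open>0\<close>;
  Parseval's identity turns this norm into the series.\<close>

lemma sine_coeff_stationary:
  assumes g1: "\<And>z. z \<in> {0..1} \<Longrightarrow> (g has_real_derivative g1 z) (at z within {0..1})"
    and g2: "\<And>z. z \<in> {0..1} \<Longrightarrow> (g1 has_real_derivative q * g z) (at z within {0..1})"
    and bc: "g 0 = 1" "g 1 = 0" and "0 \<le> q"
  shows "sine_coeff g n = 2 * freq n / (q + (freq n)\<^sup>2)"
proof -
  have cont: "continuous_on {0..1} g" using g1 by (rule DERIV_continuous_on)
  have "sine_coeff (\<lambda>z. q * g z) n = q * sine_coeff g n"
    by (simp add: sine_coeff_def mult.assoc)
  moreover have "sine_coeff (\<lambda>z. q * g z) n = 2 * freq n - (freq n)\<^sup>2 * sine_coeff g n"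
    using sine_coeff_second_derivative[OF g1 g2, of n] bc cont by (simp add: continuous_intros)
  ultimately have "(q + (freq n)\<^sup>2) * sine_coeff g n = 2 * freq n"
    by (simp add: algebra_simps)
  moreover have "q + (freq n)\<^sup>2 > 0" using \<open>0 \<le> q\<close> by (simp add: add_nonneg_pos)
  ultimately show ?thesis by (simp add: field_simps)
qed

lemma iss_gain_stationary:
  assumes "0 < D" "0 \<le> c"
    and g1: "\<And>z. z \<in> {0..1} \<Longrightarrow> (g has_real_derivative g1 z) (at z within {0..1})"
    and g2: "\<And>z. z \<in> {0..1} \<Longrightarrow> (g1 has_real_derivative c / D * g z) (at z within {0..1})"
    and bc: "g 0 = 1" "g 1 = 0"
  shows "iss_gain D c = L2_norm01 g"
    and "(\<lambda>n. (2 * D * freq n / (c + D * (freq n)\<^sup>2))\<^sup>2 / 2) sums (iss_gain D c)\<^sup>2"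
proof -
  let ?q = "\<lambda>n. (real (Suc n))\<^sup>2 / (c / D / pi\<^sup>2 + (real (Suc n))\<^sup>2)\<^sup>2"
  have cont: "continuous_on {0..1} g" using g1 by (rule DERIV_continuous_on)
  have L2: "(L2_norm01 g)\<^sup>2 = integral {0..1} (\<lambda>z. (g z)\<^sup>2)"
    unfolding L2_norm01_def
    by (intro real_sqrt_pow2 integral_nonneg integrable_continuous_real continuous_intros cont) auto
  have coeff: "sine_coeff g n = 2 * D * freq n / (c + D * (freq n)\<^sup>2)" for n
  proof -
    have "D * (c / D + (freq n)\<^sup>2) = c + D * (freq n)\<^sup>2" using \<open>0 < D\<close> by (simp add: field_simps)
    then show ?thesis
      using sine_coeff_stationary[OF g1 g2 bc, of n] assms(1,2)
        mult_divide_mult_cancel_left[of D "2 * freq n" "c / D + (freq n)\<^sup>2"] by (simp add: mult_ac)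
  qed
  have sums: "(\<lambda>n. (2 * D * freq n / (c + D * (freq n)\<^sup>2))\<^sup>2 / 2) sums (L2_norm01 g)\<^sup>2"
    using sine_parseval[OF cont] by (simp add: coeff L2)
  \<comment> \<open>Extending the fraction by D pi^2 exhibits the squared mode gain. The constant
    pi^2 / 2 is what the prefactor sqrt 2 / pi of the gain cancels.\<close>
  have summand: "?q n = pi\<^sup>2 / 2 * ((2 * D * freq n / (c + D * (freq n)\<^sup>2))\<^sup>2 / 2)" for n
  proof -
    define m where "m = real (Suc n)"
    have w: "freq n = m * pi" by (simp add: freq_def m_def)
    have pos: "0 < c + D * (m * pi)\<^sup>2"
      using assms(1,2) by (intro add_nonneg_pos) (auto simp: m_def)
    have "c / D / pi\<^sup>2 + m\<^sup>2 = (c + D * (m * pi)\<^sup>2) / (D * pi\<^sup>2)"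
      using \<open>0 < D\<close> by (simp add: field_simps power_mult_distrib)
    then have "m\<^sup>2 / (c / D / pi\<^sup>2 + m\<^sup>2)\<^sup>2 = m\<^sup>2 * (D * pi\<^sup>2)\<^sup>2 / (c + D * (m * pi)\<^sup>2)\<^sup>2"
      by (simp add: power_divide)
    also have "\<dots> = pi\<^sup>2 / 2 * ((2 * D * (m * pi) / (c + D * (m * pi)\<^sup>2))\<^sup>2 / 2)"
      by (simp add: power_divide) (simp add: power2_eq_square mult_ac)
    finally show ?thesis by (simp only: w m_def)
  qed
  have "?q sums (pi\<^sup>2 / 2 * (L2_norm01 g)\<^sup>2)"
    unfolding summand by (rule sums_mult[OF sums])
  \<comment> \<open>Both branches of the definition are this one series: for c = 0 its terms n^2 /
    n^4 reduce to 1 / n^2.\<close>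
  moreover have "iss_gain D c = sqrt 2 / pi * sqrt (\<Sum>n. ?q n)"
  proof (cases "0 < c")
    case True
    then show ?thesis using assms(1) by (simp add: iss_gain_def)
  next
    case False
    then have "c = 0" using assms(2) by simp
    moreover have "x\<^sup>2 / x ^ 4 = 1 / x\<^sup>2" for x :: real
      by (simp add: power2_eq_square power4_eq_xxxx)
    ultimately show ?thesis by (simp add: iss_gain_def del: of_nat_Suc)
  qed
  ultimately have "iss_gain D c = sqrt 2 / pi * sqrt (pi\<^sup>2 / 2 * (L2_norm01 g)\<^sup>2)"
    by (simp add: sums_iff)
  also have "\<dots> = L2_norm01 g"
    by (simp add: real_sqrt_mult real_sqrt_divide)
  finally show "iss_gain D c = L2_norm01 g" .
  with sums show "(\<lambda>n. (2 * D * freq n / (c + D * (freq n)\<^sup>2))\<^sup>2 / 2) sums (iss_gain D c)\<^sup>2" by simp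
qed

section \<open>The gain\<close>

text \<open>The stationary profile is sinh(\<zeta> (1 - z)) / sinh \<zeta>, the solution of g'' =
  \<zeta>^2 g with boundary values 1 and 0; the closed form comes from integrating its
  square.\<close>

lemma iss_gain_pos_c:
  assumes "0 < D" "0 < c"
  defines "\<zeta> \<equiv> sqrt (c / D)"
  shows "(\<lambda>n. (2 * D * freq n / (c + D * (freq n)\<^sup>2))\<^sup>2 / 2) sums (iss_gain D c)\<^sup>2"
    and "iss_gain D c = 1 / (exp (2 * \<zeta>) - 1)
           * sqrt ((exp (4 * \<zeta>) - 1 - 4 * \<zeta> * exp (2 * \<zeta>)) / (2 * \<zeta>))"
    and "0 \<le> iss_gain D c"
proof -
  have \<zeta>: "0 < \<zeta>" "\<zeta>\<^sup>2 = c / D" using assms by auto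
  have sinh: "sinh \<zeta> \<noteq> 0" using \<zeta>(1) by simp
  define C where "C = 1 / sinh \<zeta>"
  define g where "g z = C * sinh (\<zeta> * (1 - z))" for z
  define g1 where "g1 z = - (C * \<zeta> * cosh (\<zeta> * (1 - z)))" for z
  have g1: "(g has_real_derivative g1 z) (at z within {0..1})" for z
    unfolding g_def g1_def by (rule derivative_eq_intros refl)+ simp
  have g2: "(g1 has_real_derivative c / D * g z) (at z within {0..1})" for z
    unfolding g_def g1_def \<zeta>(2)[symmetric]
    by (rule derivative_eq_intros refl)+ (simp add: power2_eq_square)
  have bc: "g 0 = 1" "g 1 = 0" using sinh by (auto simp: g_def C_def)
  note gain = iss_gain_stationary[OF assms(1) less_imp_le[OF assms(2)] g1 g2 bc]
  show "(\<lambda>n. (2 * D * freq n / (c + D * (freq n)\<^sup>2))\<^sup>2 / 2) sums (iss_gain D c)\<^sup>2"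
    by (rule gain(2))
  show "0 \<le> iss_gain D c"
    by (simp add: gain(1))
  \<comment> \<open>Antiderivative of the squared profile, obtained from sinh^2 x = (cosh(2 x) - 1)
    / 2.\<close>
  define F where "F z = (- sinh (2 * (\<zeta> * (1 - z))) / (4 * \<zeta>) - z / 2) / (sinh \<zeta>)\<^sup>2" for z
  have "((\<lambda>z. (g z)\<^sup>2) has_integral F 1 - F 0) {0..1}"
  proof (rule fundamental_theorem_of_calculus)
    fix z :: real
    have "(F has_real_derivative (cosh (2 * (\<zeta> * (1 - z))) / 2 - 1 / 2) / (sinh \<zeta>)\<^sup>2) (at z within {0..1})"
      unfolding F_def using \<zeta>(1) by (auto intro!: derivative_eq_intros simp: field_simps)
    also have "(cosh (2 * (\<zeta> * (1 - z))) / 2 - 1 / 2) / (sinh \<zeta>)\<^sup>2 = (g z)\<^sup>2"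
      unfolding cosh_double g_def C_def power_mult_distrib power_divide cosh_square_eq
      by (simp add: add_divide_distrib)
    finally show "(F has_vector_derivative (g z)\<^sup>2) (at z within {0..1})"
      by (simp add: has_real_derivative_iff_has_vector_derivative)
  qed simp
  moreover have "F 1 - F 0 = (exp (4 * \<zeta>) - 1 - 4 * \<zeta> * exp (2 * \<zeta>)) / (2 * \<zeta>) / (exp (2 * \<zeta>) - 1)\<^sup>2"
  proof -
    \<comment> \<open>In terms of E all hyperbolic functions are rational, and the claim becomes a
      rational identity.\<close>
    define E where "E = exp \<zeta>"
    have E: "1 < E" using \<zeta>(1) by (simp add: E_def)
    have pow: "exp (2 * \<zeta>) = E\<^sup>2" "exp (4 * \<zeta>) = E ^ 4" "exp (- \<zeta>) = 1 / E" "exp (- (2 * \<zeta>)) = 1 / E\<^sup>2"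
      using exp_of_nat_mult[of 2 \<zeta>] exp_of_nat_mult[of 4 \<zeta>]
      by (auto simp: E_def exp_minus inverse_eq_divide)
    have "F 1 - F 0 = ((E\<^sup>2 - 1 / E\<^sup>2) / (8 * \<zeta>) - 1 / 2) / ((E - 1 / E) / 2)\<^sup>2"
      unfolding F_def sinh_def
      by (simp add: pow E_def[symmetric] diff_divide_distrib[symmetric])
         (simp add: diff_divide_distrib)
    also have "\<dots> = ((E ^ 4 - 1 - 4 * \<zeta> * E\<^sup>2) / (8 * \<zeta> * E\<^sup>2)) / ((E\<^sup>2 - 1)\<^sup>2 / (4 * E\<^sup>2))"
    proof -
      have "(E\<^sup>2 - 1 / E\<^sup>2) / (8 * \<zeta>) - 1 / 2 = (E ^ 4 - 1 - 4 * \<zeta> * E\<^sup>2) / (8 * \<zeta> * E\<^sup>2)"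
        using E \<zeta>(1) by (simp add: field_simps)
      moreover have "((E - 1 / E) / 2)\<^sup>2 = (E\<^sup>2 - 1)\<^sup>2 / (4 * E\<^sup>2)"
        using E by (simp add: field_simps power2_eq_square)
      ultimately show ?thesis by simp
    qed
    also have "\<dots> = (E ^ 4 - 1 - 4 * \<zeta> * E\<^sup>2) / (2 * \<zeta>) / (E\<^sup>2 - 1)\<^sup>2"
    proof -
      have *: "x / (8 * \<zeta> * e) / (y / (4 * e)) = x / (2 * \<zeta>) / y" if "e \<noteq> 0" for x y e :: real
        using that by simp
      show ?thesis by (rule *) (use E in simp)
    qed
    finally show ?thesis by (simp add: pow)
  qed
  ultimately have "iss_gain D c
      = sqrt ((exp (4 * \<zeta>) - 1 - 4 * \<zeta> * exp (2 * \<zeta>)) / (2 * \<zeta>) / (exp (2 * \<zeta>) - 1)\<^sup>2)"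
    by (simp add: gain(1) L2_norm01_def integral_unique)
  also have "\<dots> = 1 / (exp (2 * \<zeta>) - 1) * sqrt ((exp (4 * \<zeta>) - 1 - 4 * \<zeta> * exp (2 * \<zeta>)) / (2 * \<zeta>))"
    using \<zeta>(1) by (simp add: real_sqrt_divide real_sqrt_mult)
  finally show "iss_gain D c = \<dots>" .
qed

lemma iss_gain_zero_c:
  assumes "0 < D"
  shows "(\<lambda>n. (2 * D * freq n / (D * (freq n)\<^sup>2))\<^sup>2 / 2) sums (iss_gain D 0)\<^sup>2"
    and "iss_gain D 0 = 1 / sqrt 3"
proof -
  let ?g = "\<lambda>z::real. 1 - z"
  have g1: "(?g has_real_derivative -1) (at z within {0..1})" for z
    by (auto intro!: derivative_eq_intros)
  have g2: "((\<lambda>z. -1) has_real_derivative 0 / D * ?g z) (at z within {0..1})" for z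
    by simp
  note gain = iss_gain_stationary[of D 0 ?g "\<lambda>z. -1", OF assms order_refl g1 g2]
  show "(\<lambda>n. (2 * D * freq n / (D * (freq n)\<^sup>2))\<^sup>2 / 2) sums (iss_gain D 0)\<^sup>2"
    using gain(2) by simp
  have "((\<lambda>z. (?g z)\<^sup>2) has_integral (- ((?g 1) ^ 3) / 3) - (- ((?g 0) ^ 3) / 3)) {0..1}"
    by (rule fundamental_theorem_of_calculus)
       (auto intro!: derivative_eq_intros simp: has_real_derivative_iff_has_vector_derivative[symmetric])
  then show "iss_gain D 0 = 1 / sqrt 3"
    using gain(1) by (simp add: L2_norm01_def integral_unique real_sqrt_divide)
qed

lemma iss_gain_sums:
  assumes "0 < D" "0 \<le> c"
  shows "(\<lambda>n. (2 * D * freq n / (c + D * (freq n)\<^sup>2))\<^sup>2 / 2) sums (iss_gain D c)\<^sup>2"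
    and "0 \<le> iss_gain D c"
proof -
  show "(\<lambda>n. (2 * D * freq n / (c + D * (freq n)\<^sup>2))\<^sup>2 / 2) sums (iss_gain D c)\<^sup>2"
    using iss_gain_pos_c(1)[of D c] iss_gain_zero_c(1)[of D] assms by (cases "c = 0") auto
  show "0 \<le> iss_gain D c"
    using iss_gain_pos_c(3)[of D c] iss_gain_zero_c(2)[of D] assms by (cases "c = 0") auto
qed

section \<open>Existence for the target problem\<close>

text \<open>The Weierstrass test with a majorant that is uniform in z but only local in t.
  Continuity is a local property, so the majorants may blow up as t tends to 0, as they do for
  derivatives of the solution.\<close>

lemma continuous_on_series_locally_dominated:
  fixes f :: "nat \<Rightarrow> 'a::metric_space \<Rightarrow> 'b::metric_space \<Rightarrow> real"
  assumes cont: "\<And>n. continuous_on (S \<times> UNIV) (\<lambda>(t, z). f n t z)"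
    and dom: "\<And>t0. t0 \<in> S \<Longrightarrow> \<exists>U m. open U \<and> t0 \<in> U \<and> summable m \<and>
      (\<forall>n. \<forall>t\<in>S \<inter> U. \<forall>z. \<bar>f n t z\<bar> \<le> m n)"
  shows "continuous_on (S \<times> UNIV) (\<lambda>(t, z). \<Sum>n. f n t z)"
  unfolding continuous_on_eq_continuous_within
proof
  fix p assume p: "p \<in> S \<times> (UNIV :: 'b set)"
  obtain U m where U: "open U" "fst p \<in> U" "summable m"
      and m: "\<And>n t z. t \<in> S \<inter> U \<Longrightarrow> \<bar>f n t z\<bar> \<le> m n"
    using dom[of "fst p"] p by force
  let ?W = "(S \<inter> U) \<times> (UNIV :: 'b set)"
  have "uniform_limit ?W (\<lambda>N p. \<Sum>n<N. f n (fst p) (snd p)) (\<lambda>p. \<Sum>n. f n (fst p) (snd p)) sequentially"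
    by (rule Weierstrass_m_test[OF _ U(3)]) (use m in auto)
  moreover have "continuous_on ?W (\<lambda>p. \<Sum>n<N. f n (fst p) (snd p))" for N
  proof (rule continuous_on_sum)
    show "continuous_on ?W (\<lambda>p. f n (fst p) (snd p))" for n
      using continuous_on_subset[OF cont, of ?W n] by (auto simp: case_prod_beta')
  qed
  ultimately have "continuous_on ?W (\<lambda>p. \<Sum>n. f n (fst p) (snd p))"
    by (intro uniform_limit_theorem[where F = sequentially]) auto
  then have "continuous (at p within ?W) (\<lambda>p. \<Sum>n. f n (fst p) (snd p))"
    using p U(2) by (auto simp: continuous_on_eq_continuous_within)
  moreover have "at p within ?W = at p within S \<times> UNIV"
    by (rule at_within_nhd[of _ "U \<times> UNIV"]) (use U p in \<open>auto intro: open_Times\<close>)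
  ultimately show "continuous (at p within S \<times> UNIV) (\<lambda>(t, z). \<Sum>n. f n t z)"
    by (simp add: case_prod_beta')
qed

lemma has_real_derivative_series_dominated:
  fixes f f' :: "nat \<Rightarrow> real \<Rightarrow> real"
  assumes "convex S" "x \<in> interior S"
    and deriv: "\<And>n y. y \<in> S \<Longrightarrow> (f n has_real_derivative f' n y) (at y)"
    and m: "summable m" "\<And>n y. y \<in> S \<Longrightarrow> \<bar>f' n y\<bar> \<le> m n"
    and "summable (\<lambda>n. f n x)"
  shows "((\<lambda>y. \<Sum>n. f n y) has_real_derivative (\<Sum>n. f' n x)) (at x)"
proof (rule has_field_derivative_series'(2)[OF assms(1)])
  show "(f n has_real_derivative f' n y) (at y within S)" if "y \<in> S" for n y
    using deriv[OF that] by (rule has_field_derivative_at_within)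
  show "uniformly_convergent_on S (\<lambda>n y. \<Sum>i<n. f' i y)"
    by (rule uniformly_convergentI[OF Weierstrass_m_test[OF _ m(1)]]) (use m(2) in auto)
  show "x \<in> S" using assms(2) interior_subset by blast
qed (use assms in auto)

text \<open>All termwise differentiation of the solution series is concentrated here. Since every
  frequency is at least 1, the majorant of freq^2 |v| also dominates freq |v| and |v|, so one
  assumption serves the series and both of its z-derivatives.\<close>

lemma sine_series_evolution:
  fixes v v' :: "nat \<Rightarrow> real \<Rightarrow> real"
  assumes v: "\<And>n t. 0 < t \<Longrightarrow> (v n has_real_derivative v' n t) (at t)"
    and cont_v': "\<And>n. continuous_on {0<..} (v' n)"
    and dom: "\<And>\<tau> T. 0 < \<tau> \<Longrightarrow> \<exists>m. summable m \<and>
      (\<forall>n. \<forall>t\<in>{\<tau>..T}. (freq n)\<^sup>2 * \<bar>v n t\<bar> \<le> m n \<and> \<bar>v' n t\<bar> \<le> m n)"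
  shows "\<And>t z. 0 < t \<Longrightarrow> ((\<lambda>\<tau>. \<Sum>n. v n \<tau> * sine_mode n z) has_real_derivative
           (\<Sum>n. v' n t * sine_mode n z)) (at t)"
    and "\<And>t z. 0 < t \<Longrightarrow> ((\<lambda>z. \<Sum>n. v n t * sine_mode n z) has_real_derivative
           (\<Sum>n. v n t * (freq n * cos (freq n * z)))) (at z)"
    and "\<And>t z. 0 < t \<Longrightarrow> ((\<lambda>z. \<Sum>n. v n t * (freq n * cos (freq n * z))) has_real_derivative
           (\<Sum>n. - (freq n)\<^sup>2 * v n t * sine_mode n z)) (at z)"
    and "continuous_on ({0<..} \<times> UNIV) (\<lambda>(t, z). \<Sum>n. v' n t * sine_mode n z)"
    and "continuous_on ({0<..} \<times> UNIV) (\<lambda>(t, z). \<Sum>n. v n t * (freq n * cos (freq n * z)))"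
    and "\<And>t. 0 < t \<Longrightarrow> continuous_on UNIV (\<lambda>z. \<Sum>n. - (freq n)\<^sup>2 * v n t * sine_mode n z)"
    and "\<And>t. 0 < t \<Longrightarrow> summable (\<lambda>n. \<bar>v n t\<bar>)"
    and "\<And>t. 0 < t \<Longrightarrow> summable (\<lambda>n. \<bar>(freq n)\<^sup>2 * v n t\<bar>)"
proof -
  have freq1: "1 \<le> freq n" for n
    using freq_ge_pi[of n] pi_ge_two by linarith
  have le1: "\<bar>v n t\<bar> \<le> freq n * \<bar>v n t\<bar>" "freq n * \<bar>v n t\<bar> \<le> (freq n)\<^sup>2 * \<bar>v n t\<bar>" for n t
    using freq1[of n] by (auto simp: mult_le_cancel_right1 power2_eq_square mult_le_cancel_right)
  have mode: "\<bar>a * sine_mode n z\<bar> \<le> \<bar>a\<bar>" for a n z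
    using mult_left_mono[OF abs_sine_mode_le_1[of n z], of "\<bar>a\<bar>"] by (simp add: abs_mult)
  have cosm: "\<bar>a * (freq n * cos (freq n * z))\<bar> \<le> freq n * \<bar>a\<bar>" for a n z
    using mult_left_mono[OF abs_cos_le_one[of "freq n * z"], of "freq n * \<bar>a\<bar>"] freq1[of n]
    by (simp add: abs_mult mult_ac)
  \<comment> \<open>The neighbourhood of t is (t/2, t + 1), which keeps a positive distance from
    time 0.\<close>
  have local: "\<exists>U m. open U \<and> t \<in> U \<and> convex U \<and> U \<subseteq> {0<..} \<and> summable m \<and>
      (\<forall>n. \<forall>t\<in>U. (freq n)\<^sup>2 * \<bar>v n t\<bar> \<le> m n \<and> \<bar>v' n t\<bar> \<le> m n)" if t: "0 < t" for t
  proof -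
    obtain m where m: "summable m"
        "\<And>n s. s \<in> {t/2..t+1} \<Longrightarrow> (freq n)\<^sup>2 * \<bar>v n s\<bar> \<le> m n \<and> \<bar>v' n s\<bar> \<le> m n"
      using dom[of "t/2" "t+1"] half_gt_zero[OF t] by blast
    show ?thesis
      by (rule exI[of _ "{t/2<..<t+1}"], rule exI[of _ m]) (use m t in auto)
  qed
  have dom1: "\<exists>m. summable m \<and> (\<forall>n. (freq n)\<^sup>2 * \<bar>v n t\<bar> \<le> m n)" if "0 < t" for t
    using dom[OF that, of t] by auto
  show sum2: "summable (\<lambda>n. \<bar>(freq n)\<^sup>2 * v n t\<bar>)" if t: "0 < t" for t
  proof -
    obtain m where m: "summable m" "\<And>n. (freq n)\<^sup>2 * \<bar>v n t\<bar> \<le> m n"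
      using dom1[OF t] by auto
    show ?thesis by (rule summable_comparison_test'[OF m(1), of 0]) (use m(2) in \<open>simp add: abs_mult\<close>)
  qed
  show sum0: "summable (\<lambda>n. \<bar>v n t\<bar>)" if t: "0 < t" for t
    by (rule summable_comparison_test'[OF sum2[OF t], of 0])
       (use order_trans[OF le1(1) le1(2)] in \<open>simp add: abs_mult\<close>)
  have sum1: "summable (\<lambda>n. freq n * \<bar>v n t\<bar>)" if t: "0 < t" for t
    by (rule summable_comparison_test'[OF sum2[OF t], of 0])
       (use le1(2) less_imp_le[OF freq_pos] in \<open>simp add: abs_mult\<close>)
  show "((\<lambda>\<tau>. \<Sum>n. v n \<tau> * sine_mode n z) has_real_derivative
           (\<Sum>n. v' n t * sine_mode n z)) (at t)" if t: "0 < t" for t z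
  proof -
    obtain U m where U: "open U" "t \<in> U" "convex U" "U \<subseteq> {0<..}" "summable m"
        "\<And>n t. t \<in> U \<Longrightarrow> \<bar>v' n t\<bar> \<le> m n"
      using local[OF t] by metis
    show ?thesis
    proof (rule has_real_derivative_series_dominated[OF U(3) _ _ U(5)])
      show "t \<in> interior U" using U by (simp add: interior_open)
      show "((\<lambda>\<tau>. v n \<tau> * sine_mode n z) has_real_derivative v' n y * sine_mode n z) (at y)"
        if "y \<in> U" for n y
        using that U(4) by (intro DERIV_cmult_right v) auto
      show "\<bar>v' n y * sine_mode n z\<bar> \<le> m n" if "y \<in> U" for n y
        using mode U(6)[OF that] by (rule order_trans)
      show "summable (\<lambda>n. v n t * sine_mode n z)"
        by (rule summable_comparison_test'[OF sum0[OF t], of 0]) (use mode in auto)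
    qed
  qed
  show "((\<lambda>z. \<Sum>n. v n t * sine_mode n z) has_real_derivative
           (\<Sum>n. v n t * (freq n * cos (freq n * z)))) (at z)" if t: "0 < t" for t z
  proof (rule has_real_derivative_series_dominated[OF convex_UNIV _ _ sum1[OF t]])
    show "((\<lambda>z. v n t * sine_mode n z) has_real_derivative v n t * (freq n * cos (freq n * y))) (at y)" for n y
      unfolding sine_mode_def by (rule derivative_eq_intros refl | simp)+
    show "summable (\<lambda>n. v n t * sine_mode n z)"
      by (rule summable_comparison_test'[OF sum0[OF t], of 0]) (use mode in auto)
  qed (use cosm in auto)
  show "((\<lambda>z. \<Sum>n. v n t * (freq n * cos (freq n * z))) has_real_derivative
           (\<Sum>n. - (freq n)\<^sup>2 * v n t * sine_mode n z)) (at z)" if t: "0 < t" for t z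
  proof (rule has_real_derivative_series_dominated[OF convex_UNIV _ _ sum2[OF t]])
    show "((\<lambda>z. v n t * (freq n * cos (freq n * z))) has_real_derivative
        - (freq n)\<^sup>2 * v n t * sine_mode n y) (at y)" for n y
      unfolding sine_mode_def by (rule derivative_eq_intros refl | simp add: power2_eq_square)+
    show "summable (\<lambda>n. v n t * (freq n * cos (freq n * z)))"
      by (rule summable_comparison_test'[OF sum1[OF t], of 0]) (use cosm in auto)
    show "\<bar>- (freq n)\<^sup>2 * v n t * sine_mode n y\<bar> \<le> \<bar>(freq n)\<^sup>2 * v n t\<bar>" for n y
      using mode[of "- (freq n)\<^sup>2 * v n t" n y] by simp
  qed auto
  have cont_v: "continuous_on {0<..} (v n)" for n
    by (rule DERIV_continuous_on[OF has_field_derivative_at_within[OF v]]) auto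
  show "continuous_on ({0<..} \<times> UNIV) (\<lambda>(t, z). \<Sum>n. v' n t * sine_mode n z)"
  proof (rule continuous_on_series_locally_dominated)
    show "continuous_on ({0<..} \<times> UNIV) (\<lambda>(t, z). v' n t * sine_mode n z)" for n
      unfolding case_prod_beta'
      by (intro continuous_intros continuous_on_compose2[OF cont_v']) auto
    fix t :: real assume "t \<in> {0<..}"
    then obtain U m where U: "open U" "t \<in> U" "summable m" "\<And>n t. t \<in> U \<Longrightarrow> \<bar>v' n t\<bar> \<le> m n"
      using local[of t] by auto
    then show "\<exists>U m. open U \<and> t \<in> U \<and> summable m \<and>
        (\<forall>n. \<forall>t\<in>{0<..} \<inter> U. \<forall>z. \<bar>v' n t * sine_mode n z\<bar> \<le> m n)"
      using mode by (meson IntD2 order_trans)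
  qed
  show "continuous_on ({0<..} \<times> UNIV) (\<lambda>(t, z). \<Sum>n. v n t * (freq n * cos (freq n * z)))"
  proof (rule continuous_on_series_locally_dominated)
    show "continuous_on ({0<..} \<times> UNIV) (\<lambda>(t, z). v n t * (freq n * cos (freq n * z)))" for n
      unfolding case_prod_beta'
      by (intro continuous_intros continuous_on_compose2[OF cont_v]) auto
    fix t :: real assume "t \<in> {0<..}"
    then obtain U m where U: "open U" "t \<in> U" "summable m"
        "\<And>n t. t \<in> U \<Longrightarrow> (freq n)\<^sup>2 * \<bar>v n t\<bar> \<le> m n"
      using local[of t] by auto
    then show "\<exists>U m. open U \<and> t \<in> U \<and> summable m \<and>
        (\<forall>n. \<forall>t\<in>{0<..} \<inter> U. \<forall>z. \<bar>v n t * (freq n * cos (freq n * z))\<bar> \<le> m n)"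
      using cosm le1(2) by (meson IntD2 order_trans)
  qed
  show "continuous_on UNIV (\<lambda>z. \<Sum>n. - (freq n)\<^sup>2 * v n t * sine_mode n z)" if t: "0 < t" for t
    using sine_series_cont(2)[of "\<lambda>n. - (freq n)\<^sup>2 * v n t"] sum2[OF t] by simp
qed

text \<open>The compatible data are corrected twice: \<open>(1 - z) d(t)\<close> removes the boundary value of the
  solution and \<open>\<phi>(z) (d'(t) + c d(t))\<close>, where \<open>D \<phi>'' = 1 - z\<close>, the boundary value of its second
  derivative. The sine series of the remainder then converges together with its second
  derivatives.\<close>

lemma dirichlet_solution_exists:
  fixes d x0 :: "real \<Rightarrow> real"
  assumes "0 < D" "0 \<le> c" and d: "C2_on {0..} d" and x0: "C2_on {0..1} x0" "x0 0 = d 0" "x0 1 = 0"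
  shows "\<exists>x. dirichlet_solution D (- c) d x \<and> (\<forall>z\<in>{0..1}. x 0 z = x0 z)"
proof -
  obtain d1 d2 where
      d1: "\<And>t. t \<in> {0..} \<Longrightarrow> (d has_real_derivative d1 t) (at t within {0..})"
      and d2: "\<And>t. t \<in> {0..} \<Longrightarrow> (d1 has_real_derivative d2 t) (at t within {0..})"
      and cont_d2: "continuous_on {0..} d2"
    using C2_on_realE[OF d] by metis
  have within_t: "at t within {0..} = at t" if "0 < t" for t :: real
    by (rule at_within_nhd[of _ "{0<..}"]) (use that in auto)
  have cont_d: "continuous_on {0..} d" and cont_d1: "continuous_on {0..} d1"
    using DERIV_continuous_on[OF d1] DERIV_continuous_on[OF d2] by auto
  have at_d: "(d has_real_derivative d1 t) (at t)" "(d1 has_real_derivative d2 t) (at t)" if "0 < t" for t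
    using d1[of t] d2[of t] that by (auto simp: within_t)
  define g where "g t = d1 t + c * d t" for t
  \<comment> \<open>For the lift L = (1 - z) d + \<phi> g, the expression L_t - D L_zz + c L equals
    (1 - z) (d' + c d - g) + \<phi> (g' + c g). The choice of \<open>g\<close> kills the first part,
    and \<open>h\<close> is g' + c g. What remains as a source is -\<phi> h, which vanishes at both
    ends.\<close>
  define h where "h t = d2 t + 2 * c * d1 t + c\<^sup>2 * d t" for t
  have at_g: "(g has_real_derivative d2 t + c * d1 t) (at t)" if "0 < t" for t
    unfolding g_def by (rule derivative_eq_intros refl at_d[OF that])+ simp
  have cont_g: "continuous_on {0..} g" and cont_h: "continuous_on {0..} h"
    unfolding g_def h_def by (intro continuous_intros cont_d cont_d1 cont_d2)+
  \<comment> \<open>Integrating (1 - z) / D twice leaves an affine freedom; the term -z/3 is the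
    choice that makes \<phi> vanish at both ends.\<close>
  define \<phi> where "\<phi> z = (z\<^sup>2 / 2 - z ^ 3 / 6 - z / 3) / D" for z
  define \<phi>1 where "\<phi>1 z = (z - z\<^sup>2 / 2 - 1 / 3) / D" for z
  have \<phi>1: "(\<phi> has_real_derivative \<phi>1 z) (at z within S)" for z S
    unfolding \<phi>_def \<phi>1_def using \<open>0 < D\<close> by (auto intro!: derivative_eq_intros simp: field_simps)
  have \<phi>2: "(\<phi>1 has_real_derivative (1 - z) / D) (at z within S)" for z S
    unfolding \<phi>1_def using \<open>0 < D\<close> by (auto intro!: derivative_eq_intros simp: field_simps)
  have cont_\<phi>: "continuous_on S \<phi>" and cont_\<phi>1: "continuous_on S \<phi>1" for S
    using DERIV_continuous_on[OF \<phi>1] DERIV_continuous_on[OF \<phi>2] by auto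
  have C2_\<phi>: "C2_on {0..1} \<phi>"
    by (rule C2_on_realI[OF \<phi>1 \<phi>2]) (use \<open>0 < D\<close> in \<open>auto intro!: continuous_intros\<close>)
  have \<phi>_bc: "\<phi> 0 = 0" "\<phi> 1 = 0" by (auto simp: \<phi>_def)

  \<comment> \<open>The initial remainder vanishes at both ends, but its second derivative vanishes
    at 0 only if D x_0''(0) = d'(0) + c d(0), which the data need not satisfy. Absolute summability
    of \<open>A\<close> is all the decay used below.\<close>
  define w where "w z = x0 z - (1 - z) * d 0 - \<phi> z * g 0" for z
  obtain x1 x2 where
      x1: "\<And>z. z \<in> {0..1} \<Longrightarrow> (x0 has_real_derivative x1 z) (at z within {0..1})"
      and x2: "\<And>z. z \<in> {0..1} \<Longrightarrow> (x1 has_real_derivative x2 z) (at z within {0..1})"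
      and cont_x2: "continuous_on {0..1} x2"
    using C2_on_realE[OF x0(1)] by metis
  have C2_w: "C2_on {0..1} w"
  proof (rule C2_on_realI)
    show "(w has_real_derivative x1 z + d 0 - \<phi>1 z * g 0) (at z within {0..1})" if "z \<in> {0..1}" for z
      unfolding w_def by (rule derivative_eq_intros refl x1[OF that] \<phi>1)+ simp
    show "((\<lambda>z. x1 z + d 0 - \<phi>1 z * g 0) has_real_derivative x2 z - (1 - z) / D * g 0)
        (at z within {0..1})" if "z \<in> {0..1}" for z
      by (rule derivative_eq_intros refl x2[OF that] \<phi>2)+ simp
    show "continuous_on {0..1} (\<lambda>z. x2 z - (1 - z) / D * g 0)"
      using \<open>0 < D\<close> by (intro continuous_intros cont_x2) auto
  qed
  have w_bc: "w 0 = 0" "w 1 = 0" using x0 by (auto simp: w_def \<phi>_bc)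
  define A where "A = sine_coeff w"
  define B where "B = sine_coeff \<phi>"
  have A: "summable (\<lambda>n. \<bar>A n\<bar>)" unfolding A_def by (rule summable_sine_coeff[OF C2_w w_bc])
  have B: "summable (\<lambda>n. \<bar>B n\<bar>)" unfolding B_def by (rule summable_sine_coeff[OF C2_\<phi> \<phi>_bc])
  define \<mu> where "\<mu> n = c + D * (freq n)\<^sup>2" for n
  have \<mu>: "D * (freq n)\<^sup>2 \<le> \<mu> n" "0 < \<mu> n" "D \<le> \<mu> n" for n
  proof -
    show *: "D * (freq n)\<^sup>2 \<le> \<mu> n" using \<open>0 \<le> c\<close> by (simp add: \<mu>_def)
    have "1 \<le> (freq n)\<^sup>2" using freq_ge_pi[of n] pi_ge_two by (intro one_le_power) linarith
    then have "D \<le> D * (freq n)\<^sup>2" using \<open>0 < D\<close> by simp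
    then show "D \<le> \<mu> n" using * by linarith
    then show "0 < \<mu> n" using \<open>0 < D\<close> by linarith
  qed
  define J where "J n t = integral {0..t} (\<lambda>s. exp (\<mu> n * s) * h s)" for n t
  have J: "(J n has_real_derivative exp (\<mu> n * t) * h t) (at t within {0..})" if "0 \<le> t" for n t
  proof -
    have "(J n has_real_derivative exp (\<mu> n * t) * h t) (at t within {0..t + 1})"
      unfolding J_def using that
      by (intro integral_has_real_derivative continuous_intros continuous_on_subset[OF cont_h]) auto
    moreover have "at t within {0..t + 1} = at t within {0..}"
      by (rule at_within_nhd[of _ "{..<t + 1}"]) auto
    ultimately show ?thesis by simp
  qed
  \<comment> \<open>Duhamel's formula for the n-th coefficient of the remainder, with source
    coefficient -B h.\<close>
  define v where "v n t = exp (- \<mu> n * t) * (A n - B n * J n t)" for n t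
  \<comment> \<open>The factor 1 plays the role of \<kappa>, so that \<open>linear_ode_bound\<close>
    applies literally with forcing -B h.\<close>
  define v' where "v' n t = - \<mu> n * v n t + 1 * (- B n * h t)" for n t
  have v: "(v n has_real_derivative v' n t) (at t within {0..})" if "0 \<le> t" for n t
  proof -
    have "(v n has_real_derivative exp (- \<mu> n * t) * (- \<mu> n) * (A n - B n * J n t)
        - exp (- \<mu> n * t) * (B n * (exp (\<mu> n * t) * h t))) (at t within {0..})"
      unfolding v_def by (rule derivative_eq_intros refl J[OF that])+ simp
    also have "exp (- \<mu> n * t) * (- \<mu> n) * (A n - B n * J n t)
        - exp (- \<mu> n * t) * (B n * (exp (\<mu> n * t) * h t)) = v' n t"
      by (simp add: v'_def v_def exp_minus field_simps)
    finally show ?thesis .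
  qed
  have at_v: "(v n has_real_derivative v' n t) (at t)" if "0 < t" for n t
    using v[of t n] that by (simp add: within_t)
  have cont_v: "continuous_on {0..} (v n)" for n
    using v by (intro DERIV_continuous_on) auto
  have v0: "v n 0 = A n" for n by (simp add: v_def J_def)
  have h_bounded: "\<exists>M\<ge>0. \<forall>t\<in>{0..T}. \<bar>h t\<bar> \<le> M" for T
  proof -
    have "bounded (h ` {0..T})"
      by (intro compact_imp_bounded compact_continuous_image continuous_on_subset[OF cont_h]) auto
    then obtain M where "\<And>t. t \<in> {0..T} \<Longrightarrow> \<bar>h t\<bar> \<le> M"
      unfolding bounded_iff by (metis image_eqI real_norm_def)
    then show ?thesis by (intro exI[of _ "max M 0"]) (auto simp: le_max_iff_disj)
  qed
  have v_bound: "\<bar>v n t\<bar> \<le> exp (- \<mu> n * t) * \<bar>A n\<bar> + 1 / \<mu> n * (\<bar>B n\<bar> * M)"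
    if M: "0 \<le> M" "\<And>s. s \<in> {0..T} \<Longrightarrow> \<bar>h s\<bar> \<le> M" and t: "t \<in> {0..T}" for M T t n
  proof -
    have "\<bar>v n t\<bar> \<le> exp (- \<mu> n * t) * \<bar>v n 0\<bar> + 1 / \<mu> n * (\<bar>B n\<bar> * M)"
    proof (rule linear_ode_bound[where b = "\<lambda>t. - B n * h t"])
      show "continuous_on {0..t} (v n)" by (rule continuous_on_subset[OF cont_v]) auto
      show "(v n has_real_derivative - \<mu> n * v n s + 1 * (- B n * h s)) (at s)" if "0 < s" for s
        using at_v[OF that] by (simp only: v'_def)
      show "\<bar>- B n * h s\<bar> \<le> \<bar>B n\<bar> * M" if "0 < s" "s < t" for s
        using M(2)[of s] that t by (simp add: abs_mult mult_left_mono)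
    qed (use t M(1) \<mu> in auto)
    then show ?thesis by (simp only: v0)
  qed
  define V where "V t z = (\<Sum>n. v n t * sine_mode n z)" for t z
  define Vt where "Vt t z = (\<Sum>n. v' n t * sine_mode n z)" for t z
  define Vz where "Vz t z = (\<Sum>n. v n t * (freq n * cos (freq n * z)))" for t z
  define Vzz where "Vzz t z = (\<Sum>n. - (freq n)\<^sup>2 * v n t * sine_mode n z)" for t z

  \<comment> \<open>Smoothing away from t = 0: the factor \<mu> is absorbed by the exponential in
    the initial part, at the price 1/\<tau>, and by the division by \<mu> in the forced part. The
    doubled term in \<open>m\<close> accounts for the forcing appearing once more in v'.\<close>
  have dom: "\<exists>m. summable m \<and> (\<forall>n. \<forall>t\<in>{\<tau>..T}. (freq n)\<^sup>2 * \<bar>v n t\<bar> \<le> m n \<and> \<bar>v' n t\<bar> \<le> m n)"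
    if "0 < \<tau>" for \<tau> T
  proof -
    obtain M where M: "0 \<le> M" "\<And>s. s \<in> {0..T} \<Longrightarrow> \<bar>h s\<bar> \<le> M"
      using h_bounded[of T] by blast
    define m where "m n = \<bar>A n\<bar> / \<tau> + 2 * M * \<bar>B n\<bar>" for n
    have m: "summable m"
      unfolding m_def using A B by (intro summable_add summable_divide summable_mult) auto
    have m0: "0 \<le> m n" for n using M(1) \<open>0 < \<tau>\<close> by (simp add: m_def)
    have main: "\<mu> n * \<bar>v n t\<bar> \<le> \<bar>A n\<bar> / \<tau> + M * \<bar>B n\<bar>" if t: "t \<in> {\<tau>..T}" for n t
    proof -
      have tT: "t \<in> {0..T}" using t \<open>0 < \<tau>\<close> by auto
      \<comment> \<open>From x < 1 + x \<le> e^x with x = \<mu> t one gets \<mu> e^(-\<mu> t) \<le>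
        1/\<tau>.\<close>
      have "\<mu> n * \<tau> \<le> \<mu> n * t" using t \<mu>(2)[of n] by simp
      also have "\<dots> \<le> exp (\<mu> n * t)" using exp_ge_add_one_self[of "\<mu> n * t"] by linarith
      finally have "\<mu> n * exp (- \<mu> n * t) \<le> 1 / \<tau>"
        using \<open>0 < \<tau>\<close> by (simp add: exp_minus field_simps)
      then have e: "\<mu> n * exp (- \<mu> n * t) * \<bar>A n\<bar> \<le> 1 / \<tau> * \<bar>A n\<bar>"
        by (intro mult_right_mono) auto
      have "\<mu> n * \<bar>v n t\<bar> \<le> \<mu> n * (exp (- \<mu> n * t) * \<bar>A n\<bar> + 1 / \<mu> n * (\<bar>B n\<bar> * M))"
        using v_bound[OF M tT, of n] \<mu>(2)[of n] by (intro mult_left_mono) auto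
      also have "\<dots> = \<mu> n * exp (- \<mu> n * t) * \<bar>A n\<bar> + M * \<bar>B n\<bar>"
        using \<mu>(2)[of n] by (simp add: distrib_left mult_ac)
      finally show ?thesis using e by simp
    qed
    have "\<bar>v' n t\<bar> \<le> m n" if t: "t \<in> {\<tau>..T}" for n t
    proof -
      have "\<bar>v' n t\<bar> \<le> \<mu> n * \<bar>v n t\<bar> + \<bar>B n\<bar> * \<bar>h t\<bar>"
        using abs_triangle_ineq4[of "- \<mu> n * v n t" "B n * h t"] \<mu>(2)[of n]
        by (simp add: v'_def abs_mult)
      also have "\<bar>B n\<bar> * \<bar>h t\<bar> \<le> \<bar>B n\<bar> * M"
        using M(2)[of t] t \<open>0 < \<tau>\<close> by (intro mult_left_mono) auto
      finally show ?thesis using main[OF t, of n] by (simp add: m_def mult_ac)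
    qed
    moreover have "(freq n)\<^sup>2 * \<bar>v n t\<bar> \<le> m n / D" if t: "t \<in> {\<tau>..T}" for n t
    proof -
      have "D * (freq n)\<^sup>2 * \<bar>v n t\<bar> \<le> \<mu> n * \<bar>v n t\<bar>" using \<mu>(1) by (intro mult_right_mono) auto
      also have "\<dots> \<le> m n"
        using main[OF t, of n] mult_nonneg_nonneg[OF M(1) abs_ge_zero[of "B n"]] by (simp add: m_def)
      finally show ?thesis using \<open>0 < D\<close> by (simp add: field_simps)
    qed
    moreover have "summable (\<lambda>n. m n + m n / D)"
      using m by (intro summable_add summable_divide)
    moreover have "m n \<le> m n + m n / D" "m n / D \<le> m n + m n / D" for n
      using m0[of n] \<open>0 < D\<close> by auto
    ultimately show ?thesis
      by (intro exI[of _ "\<lambda>n. m n + m n / D"]) (meson order_trans)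
  qed
  have cont_v': "continuous_on {0<..} (v' n)" for n
    unfolding v'_def
    by (intro continuous_intros continuous_on_subset[OF cont_v] continuous_on_subset[OF cont_h]) auto
  note evolution = sine_series_evolution[OF at_v cont_v' dom]
  have evol: "((\<lambda>\<tau>. V \<tau> z) has_real_derivative Vt t z) (at t)"
      "(V t has_real_derivative Vz t z) (at z)" "(Vz t has_real_derivative Vzz t z) (at z)"
      "continuous_on UNIV (Vzz t)" "summable (\<lambda>n. \<bar>v n t\<bar>)" "summable (\<lambda>n. \<bar>(freq n)\<^sup>2 * v n t\<bar>)"
    if "0 < t" for t z
    unfolding V_def[abs_def] Vt_def[abs_def] Vz_def[abs_def] Vzz_def[abs_def]
    by (rule evolution, assumption, assumption, rule that)+
  have cont_Vt: "continuous_on ({0<..} \<times> UNIV) (\<lambda>(t, z). Vt t z)"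
    and cont_Vz: "continuous_on ({0<..} \<times> UNIV) (\<lambda>(t, z). Vz t z)"
    unfolding Vt_def Vz_def by (rule evolution, assumption, assumption)+

  \<comment> \<open>Up to t = 0 the price 1/\<tau> is unaffordable. Without derivatives no factor
    \<mu> has to be absorbed, so |A| and |B| themselves give the majorant.\<close>
  have cont_V: "continuous_on ({0..} \<times> UNIV) (\<lambda>(t, z). V t z)"
    unfolding V_def
  proof (rule continuous_on_series_locally_dominated)
    show "continuous_on ({0..} \<times> UNIV) (\<lambda>(t, z). v n t * sine_mode n z)" for n
      unfolding case_prod_beta'
      by (intro continuous_intros continuous_on_compose2[OF cont_v]) auto
    fix t0 :: real assume "t0 \<in> {0..}"
    obtain M where M: "0 \<le> M" "\<And>s. s \<in> {0..t0 + 1} \<Longrightarrow> \<bar>h s\<bar> \<le> M"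
      using h_bounded[of "t0 + 1"] by blast
    have "\<bar>v n t * sine_mode n z\<bar> \<le> \<bar>A n\<bar> + \<bar>B n\<bar> * M / D" if t: "t \<in> {0..t0 + 1}" for n t z
    proof -
      have "\<bar>v n t * sine_mode n z\<bar> \<le> \<bar>v n t\<bar>"
        using mult_left_mono[OF abs_sine_mode_le_1[of n z], of "\<bar>v n t\<bar>"] by (simp add: abs_mult)
      also have "\<dots> \<le> exp (- \<mu> n * t) * \<bar>A n\<bar> + 1 / \<mu> n * (\<bar>B n\<bar> * M)"
        by (rule v_bound[OF M t])
      also have "exp (- \<mu> n * t) * \<bar>A n\<bar> \<le> 1 * \<bar>A n\<bar>"
        using t \<mu>(2)[of n] by (intro mult_right_mono) auto
      also have "1 / \<mu> n * (\<bar>B n\<bar> * M) \<le> 1 / D * (\<bar>B n\<bar> * M)"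
        using M(1) \<mu>(3)[of n] \<open>0 < D\<close> by (intro mult_right_mono divide_left_mono) auto
      finally show ?thesis by simp
    qed
    moreover have "summable (\<lambda>n. \<bar>A n\<bar> + \<bar>B n\<bar> * M / D)"
      using A B by (intro summable_add summable_divide summable_mult2) auto
    ultimately show "\<exists>U m. open U \<and> t0 \<in> U \<and> summable m \<and>
        (\<forall>n. \<forall>t\<in>{0..} \<inter> U. \<forall>z. \<bar>v n t * sine_mode n z\<bar> \<le> m n)"
      by (intro exI[of _ "{..<t0 + 1}"] exI[of _ "\<lambda>n. \<bar>A n\<bar> + \<bar>B n\<bar> * M / D"]) auto
  qed
  have V0: "V 0 z = w z" if "z \<in> {0..1}" for z
    using sine_series_eq[OF C2_w w_bc that] by (simp add: V_def v0 A_def)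
  have V_bc: "V t 0 = 0" "V t 1 = 0" for t by (simp_all add: V_def)
  \<comment> \<open>The source \<phi> is replaced by its own sine series, legitimate as \<phi>
    vanishes at both ends; the equation then holds term by term.\<close>
  have Vt: "Vt t z = D * Vzz t z - c * V t z - \<phi> z * h t" if t: "0 < t" and z: "z \<in> {0..1}" for t z
  proof -
    have mode: "summable (\<lambda>n. a n * sine_mode n z)" if "summable (\<lambda>n. \<bar>a n\<bar>)" for a
      by (rule summable_comparison_test'[OF that, of 0]) (simp add: abs_mult mult_left_le)
    have "(\<lambda>n. v n t * sine_mode n z) sums V t z"
      unfolding V_def by (intro summable_sums mode evol(5) t)
    moreover have "(\<lambda>n. - (freq n)\<^sup>2 * v n t * sine_mode n z) sums Vzz t z"
      unfolding Vzz_def using evol(6)[OF t] by (intro summable_sums mode) simp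
    moreover have "(\<lambda>n. B n * sine_mode n z) sums \<phi> z"
      using summable_sums[OF mode[OF B]] sine_series_eq[OF C2_\<phi> \<phi>_bc z] by (simp add: B_def)
    ultimately have "(\<lambda>n. D * (- (freq n)\<^sup>2 * v n t * sine_mode n z) - c * (v n t * sine_mode n z)
        - B n * sine_mode n z * h t) sums (D * Vzz t z - c * V t z - \<phi> z * h t)"
      by (intro sums_diff sums_mult sums_mult2)
    moreover have "D * (- (freq n)\<^sup>2 * v n t * sine_mode n z) - c * (v n t * sine_mode n z)
        - B n * sine_mode n z * h t = v' n t * sine_mode n z" for n
      by (simp add: v'_def \<mu>_def algebra_simps)
    ultimately show ?thesis by (simp add: Vt_def sums_iff)
  qed

  define x where "x t z = (1 - z) * d t + \<phi> z * g t + V t z" for t z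
  define xt where "xt t z = (1 - z) * d1 t + \<phi> z * (d2 t + c * d1 t) + Vt t z" for t z
  define xz where "xz t z = - d t + \<phi>1 z * g t + Vz t z" for t z
  define xzz where "xzz t z = (1 - z) / D * g t + Vzz t z" for t z
  have xt: "((\<lambda>\<tau>. x \<tau> z) has_real_derivative xt t z) (at t)" if t: "0 < t" for t z
    unfolding x_def xt_def by (rule derivative_eq_intros refl at_d[OF t] at_g[OF t] evol(1)[OF t])+ simp
  have xz: "(x t has_real_derivative xz t z) (at z)" if t: "0 < t" for t z
    unfolding x_def xz_def by (rule derivative_eq_intros refl \<phi>1 evol(2)[OF t])+ simp
  have xzz: "(xz t has_real_derivative xzz t z) (at z)" if t: "0 < t" for t z
    unfolding xz_def xzz_def by (rule derivative_eq_intros refl \<phi>2 evol(3)[OF t])+ simp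
  have x_init: "x 0 z = x0 z" if "z \<in> {0..1}" for z
    using V0[OF that] by (simp add: x_def w_def)

  have "dirichlet_solution D (- c) d x"
    unfolding dirichlet_solution_def
  proof (intro conjI allI impI ballI)
    show "continuous_on ({0..} \<times> {0..1}) (\<lambda>(t, z). x t z)"
      unfolding x_def case_prod_beta'
      by (intro continuous_intros continuous_on_compose2[OF cont_d] continuous_on_compose2[OF cont_g]
          continuous_on_compose2[OF cont_\<phi>] continuous_on_subset[OF cont_V[unfolded case_prod_beta']]) auto
    show "C1_on ({0<..} \<times> {0..1}) (\<lambda>(t, z). x t z)"
    proof (rule C1_on_prodI)
      show "((\<lambda>\<tau>. x \<tau> z) has_real_derivative xt t z) (at t within {0<..})" if "t \<in> {0<..}" for t z
        using xt that by (auto intro: has_field_derivative_at_within)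
      show "(x t has_real_derivative xz t z) (at z within {0..1})" if "t \<in> {0<..}" for t z
        using xz that by (auto intro: has_field_derivative_at_within)
      show "continuous_on ({0<..} \<times> {0..1}) (\<lambda>(t, z). xt t z)"
        unfolding xt_def case_prod_beta'
        by (intro continuous_intros continuous_on_compose2[OF cont_d1] continuous_on_compose2[OF cont_d2]
            continuous_on_compose2[OF cont_\<phi>] continuous_on_subset[OF cont_Vt[unfolded case_prod_beta']]) auto
      show "continuous_on ({0<..} \<times> {0..1}) (\<lambda>(t, z). xz t z)"
        unfolding xz_def case_prod_beta'
        by (intro continuous_intros continuous_on_compose2[OF cont_d] continuous_on_compose2[OF cont_g]
            continuous_on_compose2[OF cont_\<phi>1] continuous_on_subset[OF cont_Vz[unfolded case_prod_beta']]) auto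
    qed auto
    show "C2_on {0..1} (x t)" if "0 \<le> t" for t
    \<comment> \<open>At t = 0 the second z-derivative of the series is not controlled, but there
      the profile is the C^2 datum \<open>x0\<close>.\<close>
    proof (cases "t = 0")
      case True
      then show ?thesis using C2_on_cong[of "{0..1}" "x 0" x0] x_init x0(1) by simp
    next
      case False
      then have t: "0 < t" using that by simp
      show ?thesis
      proof (rule C2_on_realI)
        show "(x t has_real_derivative xz t z) (at z within {0..1})" for z
          using xz[OF t] by (rule has_field_derivative_at_within)
        show "(xz t has_real_derivative xzz t z) (at z within {0..1})" for z
          using xzz[OF t] by (rule has_field_derivative_at_within)
        show "continuous_on {0..1} (xzz t)"
          unfolding xzz_def using \<open>0 < D\<close>
          by (intro continuous_intros continuous_on_subset[OF evol(4)[OF t]]) auto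
      qed
    qed
    show "deriv (\<lambda>\<tau>. x \<tau> z) t = D * deriv (deriv (x t)) z + - c * x t z"
      if t: "0 < t" and z: "z \<in> {0<..<1}" for t z
    proof -
      have "deriv (x t) = xz t" using xz[OF t] by (auto intro!: DERIV_imp_deriv)
      then have "deriv (deriv (x t)) z = xzz t z" using DERIV_imp_deriv[OF xzz[OF t]] by simp
      moreover have "deriv (\<lambda>\<tau>. x \<tau> z) t = xt t z" by (rule DERIV_imp_deriv[OF xt[OF t]])
      moreover have "xt t z = D * xzz t z + - c * x t z"
        using Vt[OF t, of z] z \<open>0 < D\<close>
        by (simp add: xt_def xzz_def x_def g_def h_def distrib_left) (simp add: algebra_simps power2_eq_square)
      ultimately show ?thesis by simp
    qed
    show "x t 0 = d t" "x t 1 = 0" for t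
      by (simp_all add: x_def \<phi>_bc V_bc)
  qed
  then show ?thesis using x_init by blast
qed

section \<open>Volterra transformations\<close>

text \<open>The substitution \<open>s = z + (1 - z) \<sigma>\<close> fixes the domain of integration, so that differentiation
  under the integral sign applies.\<close>

lemma integral_affine_unit_interval:
  fixes g :: "real \<Rightarrow> real"
  assumes z: "z \<in> {0..1}" and g: "continuous_on {z..1} g"
  shows "integral {z..1} g = (1 - z) * integral {0..1} (\<lambda>\<sigma>. g (z + (1 - z) * \<sigma>))"
\<comment> \<open>The substitution divides by 1 - z; at z = 1 both sides are 0.\<close>
proof (cases "z = 1")
  case False
  then have "z < 1" using z by simp
  have "((\<lambda>\<sigma>. g ((1 - z) *\<^sub>R \<sigma> + z)) has_integral (1 / \<bar>1 - z\<bar> ^ DIM(real)) *\<^sub>R integral {z..1} g)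
      ((\<lambda>x. (1 / (1 - z)) *\<^sub>R x + - ((1 / (1 - z)) *\<^sub>R z)) ` cbox z 1)"
    by (rule has_integral_affinity)
       (use \<open>z < 1\<close> g in \<open>auto intro: integrable_integral integrable_continuous_real\<close>)
  moreover have "(\<lambda>x. (1 / (1 - z)) *\<^sub>R x + - ((1 / (1 - z)) *\<^sub>R z)) ` cbox z 1 = {0..1}"
    using \<open>z < 1\<close> by (subst image_affinity_cbox) (auto simp: diff_divide_distrib[symmetric])
  ultimately have "((\<lambda>\<sigma>. g (z + (1 - z) * \<sigma>)) has_integral integral {z..1} g / (1 - z)) {0..1}"
    using \<open>z < 1\<close> by (simp add: add.commute)
  then show ?thesis using \<open>z < 1\<close> by (simp add: integral_unique)
qed simp

lemma affine_unit_interval_mem: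
  fixes \<sigma> z :: real
  assumes "\<sigma> \<in> {0..1}" "z \<in> {0..1}"
  shows "z + (1 - z) * \<sigma> \<in> {0..1}"
proof -
  have "(1 - z) * \<sigma> \<le> (1 - z) * 1" "0 \<le> (1 - z) * \<sigma>"
    using assms by (intro mult_left_mono mult_nonneg_nonneg; simp)+
  then show ?thesis using assms by simp
qed

lemma continuous_on_slice:
  assumes "continuous_on (S \<times> T) (\<lambda>(z, s). k z s)" "z \<in> S" "T' \<subseteq> T"
  shows "continuous_on T' (k z)"
proof -
  have "continuous_on T' (Pair z)" by (intro continuous_intros)
  moreover have "Pair z ` T' \<subseteq> S \<times> T" using assms(2,3) by auto
  ultimately have "continuous_on T' (\<lambda>s. case (z, s) of (z, s) \<Rightarrow> k z s)"
    by (rule continuous_on_compose2[OF assms(1)])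
  then show ?thesis by simp
qed

lemma C2_on_square_slice_continuous:
  fixes k :: "real \<Rightarrow> real \<Rightarrow> real"
  assumes "C2_on ({0..1} \<times> {0..1}) (\<lambda>(z, s). k z s)" "z \<in> {0..1}"
  shows "continuous_on {z..1} (k z)"
  by (rule continuous_on_slice[OF C2_on_imp_continuous_on[OF assms(1)] assms(2)]) (use assms(2) in auto)

text \<open>An initial profile is not a solution, so the mapping property of the kernels says
  nothing about its smoothness. After the substitution the integrand is, for each fixed \<sigma>, a
  C^2 function of z on the segment from (0, \<sigma>) to (1, 1), which stays inside the
  square.\<close>

lemma C2_on_volterra:
  assumes k: "C2_on ({0..1} \<times> {0..1}) (\<lambda>(z, s). k z s)" and f: "C2_on {0..1} f"
  shows "C2_on {0..1} (volterra k f)"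
proof -
  let ?Q = "{0..1} \<times> {0..1 :: real}"
  let ?K = "\<lambda>(z, s). k z s :: real"
  obtain k' :: "real \<times> real \<Rightarrow> (real \<times> real) \<Rightarrow>\<^sub>L real"
    and k'' :: "real \<times> real \<Rightarrow> (real \<times> real) \<Rightarrow>\<^sub>L (real \<times> real) \<Rightarrow>\<^sub>L real" where
      k': "\<And>x. x \<in> ?Q \<Longrightarrow> (?K has_derivative k' x) (at x within ?Q)"
      and k'': "\<And>x. x \<in> ?Q \<Longrightarrow> (k' has_derivative k'' x) (at x within ?Q)"
      and cont_k'': "continuous_on ?Q k''"
    using k unfolding C2_on_def C1_on_def by blast
  have cont_k: "continuous_on ?Q ?K" by (rule C2_on_imp_continuous_on[OF k])
  have cont_k': "continuous_on ?Q k'" using k'' by (rule has_derivative_continuous_on)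
  obtain f1 f2 where
      f1: "\<And>z. z \<in> {0..1} \<Longrightarrow> (f has_real_derivative f1 z) (at z within {0..1})"
      and f2: "\<And>z. z \<in> {0..1} \<Longrightarrow> (f1 has_real_derivative f2 z) (at z within {0..1})"
      and cont_f2: "continuous_on {0..1} f2"
    using C2_on_realE[OF f] by metis
  have cont_f: "continuous_on {0..1} f" and cont_f1: "continuous_on {0..1} f1"
    using DERIV_continuous_on[OF f1] DERIV_continuous_on[OF f2] by auto

  define p where "p \<sigma> z = z + (1 - z) * \<sigma>" for \<sigma> z :: real
  \<comment> \<open>The direction of that segment, along which the total derivatives of the kernel
    are evaluated.\<close>
  define e where "e \<sigma> = (1 :: real, 1 - \<sigma>)" for \<sigma> :: real
  have p01: "p \<sigma> z \<in> {0..1}" if "\<sigma> \<in> {0..1}" "z \<in> {0..1}" for \<sigma> z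
    unfolding p_def by (rule affine_unit_interval_mem[OF that])
  have p: "(p \<sigma> has_real_derivative 1 - \<sigma>) (at z within S)" for \<sigma> z S
    unfolding p_def by (auto intro!: derivative_eq_intros)
  have pair: "((\<lambda>z. (z, p \<sigma> z)) has_derivative (\<lambda>h. h *\<^sub>R e \<sigma>)) (at z within S)" for \<sigma> z S
  proof -
    have "(p \<sigma> has_derivative (\<lambda>h. (1 - \<sigma>) * h)) (at z within S)"
      using p[unfolded has_field_derivative_def] .
    from has_derivative_Pair[OF has_derivative_ident this] show ?thesis
      by (simp add: e_def mult.commute)
  qed

  define K where "K z \<sigma> = k z (p \<sigma> z)" for z \<sigma>
  define K1 where "K1 z \<sigma> = blinfun_apply (k' (z, p \<sigma> z)) (e \<sigma>)" for z \<sigma>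
  define K2 where "K2 z \<sigma> = blinfun_apply (blinfun_apply (k'' (z, p \<sigma> z)) (e \<sigma>)) (e \<sigma>)" for z \<sigma>
  have img: "(\<lambda>z. (z, p \<sigma> z)) ` {0..1} \<subseteq> ?Q" if "\<sigma> \<in> {0..1}" for \<sigma>
    using p01[OF that] by auto
  have K1: "((\<lambda>z. K z \<sigma>) has_real_derivative K1 z \<sigma>) (at z within {0..1})"
    if z: "z \<in> {0..1}" and \<sigma>: "\<sigma> \<in> {0..1}" for z \<sigma>
  proof -
    have "(?K has_derivative k' (z, p \<sigma> z)) (at (z, p \<sigma> z) within (\<lambda>z. (z, p \<sigma> z)) ` {0..1})"
      by (rule has_derivative_subset[OF k' img[OF \<sigma>]]) (use p01[OF \<sigma> z] z in auto)
    from diff_chain_within[OF pair this]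
    have "((\<lambda>z. K z \<sigma>) has_derivative (\<lambda>h. h *\<^sub>R K1 z \<sigma>)) (at z within {0..1})"
      by (simp add: o_def K_def K1_def blinfun.scaleR_right)
    then show ?thesis
      unfolding has_field_derivative_def by (simp only: real_scaleR_def mult.commute[of _ "K1 z \<sigma>"])
  qed
  have K2: "((\<lambda>z. K1 z \<sigma>) has_real_derivative K2 z \<sigma>) (at z within {0..1})"
    if z: "z \<in> {0..1}" and \<sigma>: "\<sigma> \<in> {0..1}" for z \<sigma>
  proof -
    have "(k' has_derivative k'' (z, p \<sigma> z)) (at (z, p \<sigma> z) within (\<lambda>z. (z, p \<sigma> z)) ` {0..1})"
      by (rule has_derivative_subset[OF k'' img[OF \<sigma>]]) (use p01[OF \<sigma> z] z in auto)
    from bounded_linear.has_derivative[OF blinfun.bounded_linear_left diff_chain_within[OF pair this], of "e \<sigma>"]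
    have "((\<lambda>z. K1 z \<sigma>) has_derivative (\<lambda>h. h *\<^sub>R K2 z \<sigma>)) (at z within {0..1})"
      by (simp add: o_def K1_def K2_def blinfun.scaleR_right blinfun.scaleR_left)
    then show ?thesis
      unfolding has_field_derivative_def by (simp only: real_scaleR_def mult.commute[of _ "K2 z \<sigma>"])
  qed
  define F where "F z \<sigma> = f (p \<sigma> z)" for z \<sigma>
  define F1 where "F1 z \<sigma> = f1 (p \<sigma> z) * (1 - \<sigma>)" for z \<sigma>
  define F2 where "F2 z \<sigma> = f2 (p \<sigma> z) * (1 - \<sigma>) * (1 - \<sigma>)" for z \<sigma>
  have chain: "((\<lambda>z. g (p \<sigma> z)) has_real_derivative g' (p \<sigma> z) * (1 - \<sigma>)) (at z within {0..1})"
    if g: "\<And>z. z \<in> {0..1} \<Longrightarrow> (g has_real_derivative g' z) (at z within {0..1})"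
      and z: "z \<in> {0..1}" and \<sigma>: "\<sigma> \<in> {0..1}" for g g' z \<sigma>
  proof -
    have "(g has_real_derivative g' (p \<sigma> z)) (at (p \<sigma> z) within p \<sigma> ` {0..1})"
      by (rule DERIV_subset[OF g[OF p01[OF \<sigma> z]]]) (use p01[OF \<sigma>] in auto)
    from DERIV_image_chain[OF this p] show ?thesis by (simp add: o_def)
  qed
  have F1: "((\<lambda>z. F z \<sigma>) has_real_derivative F1 z \<sigma>) (at z within {0..1})"
    if "z \<in> {0..1}" "\<sigma> \<in> {0..1}" for z \<sigma>
    unfolding F_def F1_def by (rule chain[OF f1 that])
  have F2: "((\<lambda>z. F1 z \<sigma>) has_real_derivative F2 z \<sigma>) (at z within {0..1})"
    if "z \<in> {0..1}" "\<sigma> \<in> {0..1}" for z \<sigma>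
    unfolding F1_def F2_def by (rule DERIV_cmult_right[OF chain[OF f2 that]])

  have cont_p: "continuous_on S (\<lambda>q. p (snd q) (fst q))" for S
    unfolding p_def by (intro continuous_intros)
  have cont_e: "continuous_on S (\<lambda>q. e (snd q))" for S :: "(real \<times> real) set"
    unfolding e_def by (intro continuous_intros)
  have cont_pair: "continuous_on ?Q (\<lambda>q. (fst q, p (snd q) (fst q)))"
    by (intro continuous_on_Pair continuous_on_fst continuous_on_id cont_p)
  have img_pair: "(\<lambda>q. (fst q, p (snd q) (fst q))) ` ?Q \<subseteq> ?Q" "(\<lambda>q. p (snd q) (fst q)) ` ?Q \<subseteq> {0..1}"
    using p01 by auto
  have cK: "continuous_on ?Q (\<lambda>(z, \<sigma>). K z \<sigma>)"
    using continuous_on_compose2[OF cont_k cont_pair img_pair(1)]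
    by (simp add: K_def case_prod_beta')
  have cK1: "continuous_on ?Q (\<lambda>(z, \<sigma>). K1 z \<sigma>)"
    using blinfun.continuous_on[OF continuous_on_compose2[OF cont_k' cont_pair img_pair(1)] cont_e]
    by (simp add: K1_def case_prod_beta')
  have cK2: "continuous_on ?Q (\<lambda>(z, \<sigma>). K2 z \<sigma>)"
    using blinfun.continuous_on[OF blinfun.continuous_on[OF
        continuous_on_compose2[OF cont_k'' cont_pair img_pair(1)] cont_e] cont_e]
    by (simp add: K2_def case_prod_beta')
  have cF: "continuous_on ?Q (\<lambda>(z, \<sigma>). F z \<sigma>)"
    using continuous_on_compose2[OF cont_f cont_p img_pair(2)] by (simp add: F_def case_prod_beta')
  have cF1: "continuous_on ?Q (\<lambda>(z, \<sigma>). F1 z \<sigma>)"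
    using continuous_on_compose2[OF cont_f1 cont_p img_pair(2)]
    by (auto simp: F1_def case_prod_beta' intro!: continuous_intros)
  have cF2: "continuous_on ?Q (\<lambda>(z, \<sigma>). F2 z \<sigma>)"
    using continuous_on_compose2[OF cont_f2 cont_p img_pair(2)]
    by (auto simp: F2_def case_prod_beta' intro!: continuous_intros)
  note c = cK cK1 cK2 cF cF1 cF2

  define H where "H z \<sigma> = K z \<sigma> * F z \<sigma>" for z \<sigma>
  define H1 where "H1 z \<sigma> = K1 z \<sigma> * F z \<sigma> + F1 z \<sigma> * K z \<sigma>" for z \<sigma>
  \<comment> \<open>Left uncollected, in exactly the shape that the product rule produces from
    \<open>H1\<close>.\<close>
  define H2 where "H2 z \<sigma> = (K2 z \<sigma> * F z \<sigma> + F1 z \<sigma> * K1 z \<sigma>) + (F2 z \<sigma> * K z \<sigma> + K1 z \<sigma> * F1 z \<sigma>)" for z \<sigma>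
  have H1: "((\<lambda>z. H z \<sigma>) has_real_derivative H1 z \<sigma>) (at z within {0..1})"
    if "z \<in> {0..1}" "\<sigma> \<in> {0..1}" for z \<sigma>
    unfolding H_def H1_def by (rule DERIV_mult[OF K1[OF that] F1[OF that]])
  have H2: "((\<lambda>z. H1 z \<sigma>) has_real_derivative H2 z \<sigma>) (at z within {0..1})"
    if "z \<in> {0..1}" "\<sigma> \<in> {0..1}" for z \<sigma>
    unfolding H1_def H2_def
    by (intro DERIV_add DERIV_mult K1[OF that] K2[OF that] F1[OF that] F2[OF that])
  have cH: "continuous_on ?Q (\<lambda>(z, \<sigma>). H z \<sigma>)" "continuous_on ?Q (\<lambda>(z, \<sigma>). H1 z \<sigma>)"
    "continuous_on ?Q (\<lambda>(z, \<sigma>). H2 z \<sigma>)"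
    unfolding H_def H1_def H2_def case_prod_beta'
    by (intro continuous_on_add continuous_on_mult c[unfolded case_prod_beta'])+
  have int: "g z integrable_on cbox 0 1" if "continuous_on ?Q (\<lambda>(z, \<sigma>). g z \<sigma>)" "z \<in> {0..1}"
    for g :: "real \<Rightarrow> real \<Rightarrow> real" and z
    by (rule integrable_continuous) (use continuous_on_slice[OF that order_refl] in simp)
  define I where "I z = integral (cbox 0 1) (H z)" for z
  define I1 where "I1 z = integral (cbox 0 1) (H1 z)" for z
  define I2 where "I2 z = integral (cbox 0 1) (H2 z)" for z
  have I1: "(I has_real_derivative I1 z) (at z within {0..1})" if z: "z \<in> {0..1}" for z
    unfolding I_def I1_def
    by (rule leibniz_rule_field_derivative) (use z H1 int cH in auto)
  have I2: "(I1 has_real_derivative I2 z) (at z within {0..1})" if z: "z \<in> {0..1}" for z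
    unfolding I1_def I2_def
    by (rule leibniz_rule_field_derivative) (use z H2 int cH in auto)
  have cont_I2: "continuous_on {0..1} I2"
    unfolding I2_def by (rule integral_continuous_on_param) (use cH in auto)
  have cont_I: "continuous_on {0..1} I" "continuous_on {0..1} I1"
    using DERIV_continuous_on[OF I1] DERIV_continuous_on[OF I2] by auto

  have eq: "volterra k f z = f z + (1 - z) * I z" if z: "z \<in> {0..1}" for z
  proof -
    have "continuous_on {z..1} (\<lambda>s. k z s * f s)"
    proof (rule continuous_on_mult)
      show "continuous_on {z..1} (k z)" by (rule C2_on_square_slice_continuous[OF k z])
      show "continuous_on {z..1} f" using z by (intro continuous_on_subset[OF cont_f]) auto
    qed
    from integral_affine_unit_interval[OF z this] show ?thesis
      by (simp add: volterra_def I_def H_def[abs_def] K_def F_def p_def)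
  qed
  have "C2_on {0..1} (\<lambda>z. f z + (1 - z) * I z)"
  proof (rule C2_on_realI)
    show "((\<lambda>z. f z + (1 - z) * I z) has_real_derivative f1 z + ((1 - z) * I1 z - I z)) (at z within {0..1})"
      if "z \<in> {0..1}" for z
      by (rule derivative_eq_intros refl f1[OF that] I1[OF that])+ simp
    show "((\<lambda>z. f1 z + ((1 - z) * I1 z - I z)) has_real_derivative
        f2 z + ((1 - z) * I2 z - I1 z - I1 z)) (at z within {0..1})" if "z \<in> {0..1}" for z
      by (rule derivative_eq_intros refl f2[OF that] I2[OF that] I1[OF that])+ simp
    show "continuous_on {0..1} (\<lambda>z. f2 z + ((1 - z) * I2 z - I1 z - I1 z))"
      by (intro continuous_intros cont_f2 cont_I2 cont_I)
  qed
  then show ?thesis using C2_on_cong[of "{0..1}" "volterra k f"] eq by simp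
qed

section \<open>L^2 bounds for Volterra transforms\<close>

lemma continuous_on_integral_kernel_sq:
  fixes k :: "real \<Rightarrow> real \<Rightarrow> real"
  assumes k: "C2_on ({0..1} \<times> {0..1}) (\<lambda>(z, s). k z s)"
  shows "continuous_on {0..1} (\<lambda>z. integral {z..1} (\<lambda>s. (k z s)\<^sup>2))"
proof -
  let ?Q = "{0..1} \<times> {0..1 :: real}"
  \<comment> \<open>The same substitution fixes the moving lower limit. Continuity in z ensures that
    the outer integral in \<open>kernel_norm\<close> is a genuine one and not a default
    value.\<close>
  have "continuous_on ?Q (\<lambda>q. (fst q, fst q + (1 - fst q) * snd q))"
    by (intro continuous_intros)
  moreover have "(\<lambda>q. (fst q, fst q + (1 - fst q) * snd q)) ` ?Q \<subseteq> ?Q"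
    using affine_unit_interval_mem by (auto simp del: atLeastAtMost_iff)
  ultimately have "continuous_on ?Q
      (\<lambda>q. case (fst q, fst q + (1 - fst q) * snd q) of (z, s) \<Rightarrow> k z s)"
    by (rule continuous_on_compose2[OF C2_on_imp_continuous_on[OF k]])
  then have "continuous_on ?Q (\<lambda>q. k (fst q) (fst q + (1 - fst q) * snd q))" by simp
  then have "continuous_on ?Q (\<lambda>q. (k (fst q) (fst q + (1 - fst q) * snd q))\<^sup>2)"
    by (intro continuous_intros)
  then have cont: "continuous_on {0..1} (\<lambda>z. (1 - z) * integral (cbox 0 1) (\<lambda>\<sigma>. (k z (z + (1 - z) * \<sigma>))\<^sup>2))"
    by (intro continuous_intros integral_continuous_on_param) (simp add: case_prod_beta')
  have eq: "integral {z..1} (\<lambda>s. (k z s)\<^sup>2)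
      = (1 - z) * integral (cbox 0 1) (\<lambda>\<sigma>. (k z (z + (1 - z) * \<sigma>))\<^sup>2)" if z: "z \<in> {0..1}" for z
  proof -
    have "continuous_on {z..1} (\<lambda>s. (k z s)\<^sup>2)"
      by (intro continuous_intros C2_on_square_slice_continuous[OF k z])
    from integral_affine_unit_interval[OF z this] show ?thesis by simp
  qed
  show ?thesis by (rule continuous_on_eq[OF cont eq[symmetric]])
qed

text \<open>The quadratic t \<mapsto> integral of (t f + g)^2 is nonnegative, so its discriminant is
  not positive.\<close>

lemma integral_Cauchy_Schwarz:
  fixes f g :: "real \<Rightarrow> real"
  assumes f: "continuous_on {a..b} f" and g: "continuous_on {a..b} g"
  shows "(integral {a..b} (\<lambda>x. f x * g x))\<^sup>2 \<le> integral {a..b} (\<lambda>x. (f x)\<^sup>2) * integral {a..b} (\<lambda>x. (g x)\<^sup>2)"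
proof -
  let ?A = "integral {a..b} (\<lambda>x. (f x)\<^sup>2)" and ?B = "integral {a..b} (\<lambda>x. f x * g x)"
    and ?C = "integral {a..b} (\<lambda>x. (g x)\<^sup>2)"
  have int: "(\<lambda>x. (f x)\<^sup>2) integrable_on {a..b}" "(\<lambda>x. f x * g x) integrable_on {a..b}"
    "(\<lambda>x. (g x)\<^sup>2) integrable_on {a..b}"
    by (intro integrable_continuous_real continuous_intros f g)+
  have quad: "0 \<le> ?A * t\<^sup>2 + (2 * ?B) * t + ?C" for t
  proof -
    have "((\<lambda>x. (f x)\<^sup>2 * t\<^sup>2 + 2 * (f x * g x) * t + (g x)\<^sup>2) has_integral ?A * t\<^sup>2 + 2 * ?B * t + ?C) {a..b}"
      by (intro has_integral_add has_integral_mult_left has_integral_mult_right integrable_integral int)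
    moreover have "0 \<le> (f x)\<^sup>2 * t\<^sup>2 + 2 * (f x * g x) * t + (g x)\<^sup>2" for x
      using zero_le_power2[of "f x * t + g x"] by (simp add: power2_sum power_mult_distrib algebra_simps)
    ultimately show ?thesis by (rule has_integral_nonneg)
  qed
  show ?thesis
  proof (cases "?A = 0")
    case True
    have "?B = 0"
    proof (rule ccontr)
      assume "?B \<noteq> 0"
      \<comment> \<open>With zero leading coefficient the quadratic is affine; this t would give it
        the value -1.\<close>
      then show False using quad[of "- (?C + 1) / (2 * ?B)"] True by (simp add: field_simps)
    qed
    then show ?thesis using True by simp
  next
    case False
    moreover have "0 \<le> ?A" by (intro integral_nonneg int) auto
    ultimately have "0 < ?A" by simp
    \<comment> \<open>The minimiser of the quadratic.\<close>
    then show ?thesis using quad[of "- ?B / ?A"] by (simp add: field_simps power2_eq_square)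
  qed
qed

lemma L2_norm01_sq:
  assumes "continuous_on {0..1} f"
  shows "(L2_norm01 f)\<^sup>2 = integral {0..1} (\<lambda>z. (f z)\<^sup>2)"
  unfolding L2_norm01_def
  by (intro real_sqrt_pow2 integral_nonneg integrable_continuous_real continuous_intros assms) auto

lemma L2_norm01_triangle:
  assumes f: "continuous_on {0..1} f" and g: "continuous_on {0..1} g"
  shows "L2_norm01 (\<lambda>z. f z + g z) \<le> L2_norm01 f + L2_norm01 g"
proof -
  let ?B = "integral {0..1} (\<lambda>z. f z * g z)"
  have "?B\<^sup>2 \<le> (L2_norm01 f * L2_norm01 g)\<^sup>2"
    using integral_Cauchy_Schwarz[OF f g] by (simp add: power_mult_distrib L2_norm01_sq f g)
  then have B: "?B \<le> L2_norm01 f * L2_norm01 g"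
    by (rule power2_le_imp_le) simp
  have "((\<lambda>z. (f z)\<^sup>2 + (g z)\<^sup>2 + 2 * (f z * g z)) has_integral
      integral {0..1} (\<lambda>z. (f z)\<^sup>2) + integral {0..1} (\<lambda>z. (g z)\<^sup>2) + 2 * ?B) {0..1}"
    by (intro has_integral_add has_integral_mult_right integrable_integral
        integrable_continuous_real continuous_intros f g)
  then have "(L2_norm01 (\<lambda>z. f z + g z))\<^sup>2 = (L2_norm01 f)\<^sup>2 + (L2_norm01 g)\<^sup>2 + 2 * ?B"
    by (simp add: L2_norm01_sq f g continuous_intros power2_sum mult.assoc integral_unique)
  also have "\<dots> \<le> (L2_norm01 f + L2_norm01 g)\<^sup>2"
    using B by (simp add: power2_sum)
  finally show ?thesis by (rule power2_le_imp_le) simp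
qed

text \<open>The 1 accounts for the identity part. Cauchy-Schwarz in s at each fixed z bounds the
  integral part by \<open>kernel_norm k\<close>, the Hilbert-Schmidt norm of the kernel on the
  triangle z \<le> s.\<close>

lemma L2_norm01_volterra_le:
  assumes k: "C2_on ({0..1} \<times> {0..1}) (\<lambda>(z, s). k z s)"
    and f: "continuous_on {0..1} f" and kf: "continuous_on {0..1} (volterra k f)"
  shows "L2_norm01 (volterra k f) \<le> (1 + kernel_norm k) * L2_norm01 f"
proof -
  let ?J = "\<lambda>z. integral {z..1} (\<lambda>s. k z s * f s)" and ?N = "\<lambda>z. integral {z..1} (\<lambda>s. (k z s)\<^sup>2)"
  note slice = C2_on_square_slice_continuous[OF k]
  have cont_J: "continuous_on {0..1} ?J"
    using continuous_on_diff[OF kf f] by (simp add: volterra_def)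
  have cont_N: "continuous_on {0..1} ?N" by (rule continuous_on_integral_kernel_sq[OF k])
  have N: "0 \<le> ?N z" if "z \<in> {0..1}" for z
    by (intro integral_nonneg integrable_continuous_real continuous_intros slice that) auto
  have J: "(?J z)\<^sup>2 \<le> ?N z * (L2_norm01 f)\<^sup>2" if z: "z \<in> {0..1}" for z
  proof -
    have f': "continuous_on {z..1} f" using z by (intro continuous_on_subset[OF f]) auto
    have "(?J z)\<^sup>2 \<le> ?N z * integral {z..1} (\<lambda>s. (f s)\<^sup>2)"
      by (rule integral_Cauchy_Schwarz[OF slice[OF z] f'])
    also have "integral {z..1} (\<lambda>s. (f s)\<^sup>2) \<le> integral {0..1} (\<lambda>s. (f s)\<^sup>2)"
      using z by (intro integral_subset_le integrable_continuous_real continuous_intros f f') auto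
    finally show ?thesis
      using N[OF z] by (simp add: L2_norm01_sq f mult_left_mono)
  qed
  have "(L2_norm01 ?J)\<^sup>2 \<le> integral {0..1} (\<lambda>z. ?N z * (L2_norm01 f)\<^sup>2)"
    unfolding L2_norm01_sq[OF cont_J]
    by (intro integral_le integrable_continuous_real continuous_intros cont_J cont_N J)
  also have "\<dots> = (kernel_norm k * L2_norm01 f)\<^sup>2"
  proof -
    have "0 \<le> integral {0..1} ?N"
      by (intro integral_nonneg integrable_continuous_real cont_N N)
    then show ?thesis by (simp add: kernel_norm_def power_mult_distrib)
  qed
  finally have *: "L2_norm01 ?J \<le> kernel_norm k * L2_norm01 f"
    by (rule power2_le_imp_le)
       (auto simp: kernel_norm_def intro!: mult_nonneg_nonneg integral_nonneg integrable_continuous_real cont_N N)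
  have "L2_norm01 (volterra k f) \<le> L2_norm01 f + L2_norm01 ?J"
    using L2_norm01_triangle[OF f cont_J] by (simp add: volterra_def[abs_def])
  with * show ?thesis by (simp add: algebra_simps)
qed

lemma kernel_norm_nonneg:
  assumes k: "C2_on ({0..1} \<times> {0..1}) (\<lambda>(z, s). k z s)"
  shows "0 \<le> kernel_norm k"
proof -
  have "0 \<le> integral {z..1} (\<lambda>s. (k z s)\<^sup>2)" if "z \<in> {0..1}" for z
    by (intro integral_nonneg integrable_continuous_real continuous_intros
        C2_on_square_slice_continuous[OF k that]) auto
  then have "0 \<le> integral {0..1} (\<lambda>z. integral {z..1} (\<lambda>s. (k z s)\<^sup>2))"
    using integral_nonneg[OF integrable_continuous_real[OF continuous_on_integral_kernel_sq[OF k]]] by blast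
  then show ?thesis by (simp add: kernel_norm_def)
qed

section \<open>The closed-loop system\<close>

theorem mainTheorem3:
  fixes D p c :: real and k l :: "real \<Rightarrow> real \<Rightarrow> real"
  assumes "D > 0" and "c \<ge> 0"
    and "backstepping_kernels D p c k l"
  shows
    "(\<forall>(d :: real \<Rightarrow> real) (y0 :: real \<Rightarrow> real).
        C2_on {0..} d \<longrightarrow> C2_on {0..1} y0 \<longrightarrow>
        y0 0 = d 0 - integral {0..1} (\<lambda>s. k 0 s * y0 s) \<longrightarrow> y0 1 = 0 \<longrightarrow>
        (\<exists>y. closed_loop_solution D p k d y \<and> (\<forall>z\<in>{0..1}. y 0 z = y0 z) \<and>
           (\<forall>y'. closed_loop_solution D p k d y' \<and> (\<forall>z\<in>{0..1}. y' 0 z = y0 z) \<longrightarrow>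
              (\<forall>t\<ge>0. \<forall>z\<in>{0..1}. y' t z = y t z)) \<and>
           (\<forall>t\<ge>0. \<forall>\<epsilon>>0.
              L2_norm01 (y t) \<le>
                exp (- (c + D * pi\<^sup>2) * t) * (1 + kernel_norm l) * (1 + kernel_norm k)
                  * L2_norm01 y0 * sqrt (1 + \<epsilon>)
                + (1 + kernel_norm l) * sqrt (1 + inverse \<epsilon>) * iss_gain D c
                  * (SUP s\<in>{0..t}. \<bar>d s\<bar>)))) \<and>
     (c > 0 \<longrightarrow>
        (let \<zeta> = sqrt (c / D)
         in iss_gain D c =
              1 / (exp (2 * \<zeta>) - 1)
                * sqrt ((exp (4 * \<zeta>) - 1 - 4 * \<zeta> * exp (2 * \<zeta>)) / (2 * \<zeta>)))) \<and>
     (c = 0 \<longrightarrow> iss_gain D c = 1 / sqrt 3)"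
proof (intro conjI allI impI)
  have k: "C2_on ({0..1} \<times> {0..1}) (\<lambda>(z, s). k z s)" and l: "C2_on ({0..1} \<times> {0..1}) (\<lambda>(z, s). l z s)"
    and lk: "\<And>f z. continuous_on {0..1} f \<Longrightarrow> z \<in> {0..1} \<Longrightarrow> volterra l (volterra k f) z = f z"
    and to_target: "\<And>d y. C2_on {0..} d \<Longrightarrow> closed_loop_solution D p k d y \<Longrightarrow>
      target_solution D c d (\<lambda>t. volterra k (y t))"
    and from_target: "\<And>d x. C2_on {0..} d \<Longrightarrow> target_solution D c d x \<Longrightarrow>
      closed_loop_solution D p k d (\<lambda>t. volterra l (x t))"
    using assms(3) unfolding backstepping_kernels_def by blast+
  fix d y0 :: "real \<Rightarrow> real"
  assume d: "C2_on {0..} d" and y0: "C2_on {0..1} y0"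
    and bc0: "y0 0 = d 0 - integral {0..1} (\<lambda>s. k 0 s * y0 s)" and bc1: "y0 1 = 0"
  have cont_y0: "continuous_on {0..1} y0" by (rule C2_on_imp_continuous_on[OF y0])
  have "C2_on {0..1} (volterra k y0)" by (rule C2_on_volterra[OF k y0])
  \<comment> \<open>At 0 the transform adds back exactly the feedback integral of the compatibility
    condition; at 1 it integrates over a single point.\<close>
  moreover have "volterra k y0 0 = d 0" "volterra k y0 1 = 0"
    using bc0 bc1 by (simp_all add: volterra_def)
  ultimately obtain x where x: "dirichlet_solution D (- c) d x"
      and x_init: "\<And>z. z \<in> {0..1} \<Longrightarrow> x 0 z = volterra k y0 z"
    using dirichlet_solution_exists[OF assms(1,2) d] by blast
  \<comment> \<open>Profiles are functions on the whole line that are known to agree only on [0, 1],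
    and the transform looks at nothing else.\<close>
  have volterra_cong: "volterra q f z = volterra q g z"
    if "\<And>s. s \<in> {0..1} \<Longrightarrow> f s = g s" "z \<in> {0..1}" for q f g z
    using that unfolding volterra_def by (intro arg_cong2[of _ _ _ _ "(+)"] integral_cong) auto
  define y where "y t = volterra l (x t)" for t
  have y: "closed_loop_solution D p k d y"
    unfolding y_def using from_target[OF d] x by (simp add: target_solution_def)
  have y_init: "y 0 z = y0 z" if "z \<in> {0..1}" for z
    unfolding y_def using volterra_cong[OF x_init that, where q = l] lk[OF cont_y0 that] by simp
  have cont_x: "continuous_on {0..1} (x t)" and cont_y: "continuous_on {0..1} (y t)" if "0 \<le> t" for t
    using x y that unfolding closed_loop_solution_def dirichlet_solution_def
    by (auto intro: C2_on_imp_continuous_on)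
  have unique: "y' t z = y t z"
    if y': "closed_loop_solution D p k d y'" and init: "\<And>z. z \<in> {0..1} \<Longrightarrow> y' 0 z = y0 z"
      and t: "0 \<le> t" and z: "z \<in> {0..1}" for y' t z
  proof -
    have cont_y': "continuous_on {0..1} (y' t)"
      using y' t unfolding closed_loop_solution_def dirichlet_solution_def
      by (auto intro: C2_on_imp_continuous_on)
    \<comment> \<open>Any competing solution becomes a target solution with the same initial profile
      as \<open>x\<close>; the inverse transform carries the equality back.\<close>
    have "volterra k (y' t) s = x t s" if "s \<in> {0..1}" for s
    proof (rule dirichlet_solution_unique[OF _ x assms(1,2) _ t that])
      show "dirichlet_solution D (- c) d (\<lambda>t. volterra k (y' t))"
        using to_target[OF d y'] by (simp add: target_solution_def)
      show "volterra k (y' 0) z = x 0 z" if "z \<in> {0..1}" for z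
        using volterra_cong[OF init that, where q = k] x_init[OF that] by simp
    qed
    then have "volterra l (volterra k (y' t)) z = y t z"
      unfolding y_def by (rule volterra_cong[OF _ z])
    then show ?thesis using lk[OF cont_y' z] by simp
  qed
  have bound: "L2_norm01 (y t) \<le>
      exp (- (c + D * pi\<^sup>2) * t) * (1 + kernel_norm l) * (1 + kernel_norm k) * L2_norm01 y0 * sqrt (1 + \<epsilon>)
      + (1 + kernel_norm l) * sqrt (1 + inverse \<epsilon>) * iss_gain D c * (SUP s\<in>{0..t}. \<bar>d s\<bar>)"
    if t: "0 \<le> t" and \<epsilon>: "0 < \<epsilon>" for t \<epsilon>
  proof -
    let ?E = "exp (- (c + D * pi\<^sup>2) * t)" and ?M = "SUP s\<in>{0..t}. \<bar>d s\<bar>"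
    \<comment> \<open>Continuity on a compact interval makes the supremum an attained maximum, and
      in particular bounds the set, without which \<open>SUP\<close> would give no upper
      bound.\<close>
    have "compact ((\<lambda>s. \<bar>d s\<bar>) ` {0..t})"
      by (intro compact_continuous_image continuous_intros
          continuous_on_subset[OF C2_on_imp_continuous_on[OF d]]) auto
    then have "bdd_above ((\<lambda>s. \<bar>d s\<bar>) ` {0..t})"
      by (intro bounded_imp_bdd_above compact_imp_bounded)
    then have M: "\<bar>d s\<bar> \<le> ?M" if "s \<in> {0..t}" for s
      using that by (intro cSUP_upper)
    have "L2_norm01 (x 0) = L2_norm01 (volterra k y0)"
      unfolding L2_norm01_def using x_init by (intro arg_cong[of _ _ sqrt] integral_cong) auto
    also have "\<dots> \<le> (1 + kernel_norm k) * L2_norm01 y0"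
      by (intro L2_norm01_volterra_le C2_on_imp_continuous_on C2_on_volterra k y0)
    finally have x0: "L2_norm01 (x 0) \<le> (1 + kernel_norm k) * L2_norm01 y0" .
    have "L2_norm01 (x t) \<le> ?E * L2_norm01 (x 0) * sqrt (1 + \<epsilon>) + sqrt (1 + inverse \<epsilon>) * iss_gain D c * ?M"
      by (rule dirichlet_solution_L2_bound[OF x assms(1,2) \<epsilon> t M iss_gain_sums[OF assms(1,2)]])
    also have "?E * L2_norm01 (x 0) * sqrt (1 + \<epsilon>)
        \<le> ?E * ((1 + kernel_norm k) * L2_norm01 y0) * sqrt (1 + \<epsilon>)"
      using x0 \<epsilon> by (intro mult_right_mono mult_left_mono) auto
    finally have xt: "L2_norm01 (x t) \<le> ?E * ((1 + kernel_norm k) * L2_norm01 y0) * sqrt (1 + \<epsilon>)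
        + sqrt (1 + inverse \<epsilon>) * iss_gain D c * ?M" by simp
    have "L2_norm01 (y t) \<le> (1 + kernel_norm l) * L2_norm01 (x t)"
      using cont_x[OF t] cont_y[OF t] unfolding y_def by (intro L2_norm01_volterra_le l)
    also have "\<dots> \<le> (1 + kernel_norm l) * (?E * ((1 + kernel_norm k) * L2_norm01 y0) * sqrt (1 + \<epsilon>)
        + sqrt (1 + inverse \<epsilon>) * iss_gain D c * ?M)"
      using xt kernel_norm_nonneg[OF l] by (intro mult_left_mono) auto
    finally show ?thesis by (simp add: algebra_simps)
  qed
  show "\<exists>y. closed_loop_solution D p k d y \<and> (\<forall>z\<in>{0..1}. y 0 z = y0 z) \<and>
      (\<forall>y'. closed_loop_solution D p k d y' \<and> (\<forall>z\<in>{0..1}. y' 0 z = y0 z) \<longrightarrow>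
        (\<forall>t\<ge>0. \<forall>z\<in>{0..1}. y' t z = y t z)) \<and>
      (\<forall>t\<ge>0. \<forall>\<epsilon>>0. L2_norm01 (y t) \<le>
        exp (- (c + D * pi\<^sup>2) * t) * (1 + kernel_norm l) * (1 + kernel_norm k) * L2_norm01 y0 * sqrt (1 + \<epsilon>)
        + (1 + kernel_norm l) * sqrt (1 + inverse \<epsilon>) * iss_gain D c * (SUP s\<in>{0..t}. \<bar>d s\<bar>))"
  proof (intro exI[of _ y] conjI allI ballI impI)
    show "closed_loop_solution D p k d y" by (rule y)
    show "y 0 z = y0 z" if "z \<in> {0..1}" for z by (rule y_init[OF that])
    show "y' t z = y t z"
      if "closed_loop_solution D p k d y' \<and> (\<forall>z\<in>{0..1}. y' 0 z = y0 z)" "0 \<le> t" "z \<in> {0..1}" for y' t z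
      using unique[of y' t z] that by blast
  qed (rule bound)
next
  assume "0 < c"
  then show "let \<zeta> = sqrt (c / D)
      in iss_gain D c = 1 / (exp (2 * \<zeta>) - 1)
           * sqrt ((exp (4 * \<zeta>) - 1 - 4 * \<zeta> * exp (2 * \<zeta>)) / (2 * \<zeta>))"
    using iss_gain_pos_c(2)[OF assms(1)] by (simp add: Let_def)
next
  assume "c = 0"
  then show "iss_gain D c = 1 / sqrt 3"
    using iss_gain_zero_c(2)[OF assms(1)] by simp
qed

end
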